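(* For any $M$-matrix or inverse $M$-matrix $A$ of order $n$ and any nonnegative integers $m,k$ with $m<n$ and $k<m$, $$\frac{S_{m,m,k}(A)}{S_{m,m,k}(I_n)}\ \ge\ \frac{S_{m+1,m-1,k}(A)}{S_{m+1,m-1,k}(I_n)},$$ where $I_n$ denotes the identity matrix of order $n$.
   Context: For $\alpha\subseteq\{1,\ldots,n\}$ let $A[\alpha]$ denote the principal minor of the $n\times n$ matrix $A$ with rows and columns indexed by $\alpha$, with $A[\emptyset]:=1$, and let $\#\alpha$ be the size of $\alpha$. An $M$-matrix (possibly singular) is a square matrix all of whose principal minors are nonnegative and all of whose off-diagonal entries are nonpositive. An inverse $M$-matrix is an invertible matrix whose inverse is an $M$-matrix. For an $n\times n$ matrix $A$ and nonnegative integers $m_1,m_2,k$, $$S_{m_1,m_2,k}(A):=\sum_{\substack{\alpha,\beta\subseteq\{1,\ldots,n\}\\ \#\alpha=m_1,\ \#\beta=m_2,\ \#(\alpha\cap\beta)=k}}A[\alpha]\,A[\beta],$$ the sum being over ordered pairs $(\alpha,\beta)$. *)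

theory Defs
  imports "Jordan_Normal_Form.Determinant" "Jordan_Normal_Form.DL_Submatrix"
begin

(* Rows and columns are numbered from 0, so index sets are subsets of {..<n}. *)

definition principal_minor :: "real mat \<Rightarrow> nat set \<Rightarrow> real" where
  "principal_minor A \<alpha> = det (submatrix A \<alpha> \<alpha>)"

lemma principal_minor_empty: "principal_minor A {} = 1"
  by (simp add: principal_minor_def submatrix_def det_dim_zero)

definition M_matrix :: "real mat \<Rightarrow> bool" where
  "M_matrix A \<longleftrightarrow> square_mat A \<and>
     (\<forall>\<alpha> \<subseteq> {..<dim_row A}. principal_minor A \<alpha> \<ge> 0) \<and>
     (\<forall>i < dim_row A. \<forall>j < dim_row A. i \<noteq> j \<longrightarrow> A $$ (i, j) \<le> 0)"

definition inverse_M_matrix :: "real mat \<Rightarrow> bool" where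
  "inverse_M_matrix A \<longleftrightarrow> square_mat A \<and>
     (\<exists>B. inverts_mat A B \<and> inverts_mat B A \<and> M_matrix B)"

(* The index set is empty exactly when k > min m1 m2 or m1 + m2 > n + k, where A has order n.
   The sum is then 0 even for the identity matrix, so a quotient by it is 0 / 0 = 0. *)
definition minor_sum :: "nat \<Rightarrow> nat \<Rightarrow> nat \<Rightarrow> real mat \<Rightarrow> real" where
  "minor_sum m1 m2 k A =
     (\<Sum>(\<alpha>, \<beta>) \<in> {(\<alpha>, \<beta>). \<alpha> \<subseteq> {..<dim_row A} \<and> \<beta> \<subseteq> {..<dim_row A} \<and>
                   card \<alpha> = m1 \<and> card \<beta> = m2 \<and> card (\<alpha> \<inter> \<beta>) = k}.
        principal_minor A \<alpha> * principal_minor A \<beta>)"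

end

theory Submission
  imports Defs "HOL-Library.Disjoint_Sets"
begin

text \<open>
Fixing \<open>\<alpha> \<inter> \<beta>\<close> and \<open>\<alpha> \<union> \<beta>\<close> and passing to a Schur complement reduces the inequality for an
\<open>M\<close>-matrix to comparing the averages of \<open>a[S] a[V - S]\<close> over \<open>S \<subseteq> V\<close> of sizes \<open>p\<close> and \<open>p + 1\<close>, where
\<open>card V = 2 p\<close>. After a small perturbation the matrix is nonsingular, and a positive scaling of its
columns makes all row sums nonnegative. Expanding each row as a nonnegative combination of the vectors
\<open>e_i - e_j\<close> and \<open>e_i\<close> (the matrix-tree expansion) writes \<open>a[S] a[V - S]\<close> as a nonnegative combination,
over maps \<open>f\<close> from \<open>V\<close> to \<open>V\<close> plus a root, of the indicators that no cycle of \<open>f\<close> lies inside \<open>S\<close> or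
inside \<open>V - S\<close>. The cycles of \<open>f\<close> are disjoint, so it remains to see that the proportion of
sets of size \<open>j\<close> splitting every member of a disjoint family decreases in \<open>j\<close> beyond \<open>card V / 2\<close>.
For inverse \<open>M\<close>-matrices, Jacobi's identity for complementary minors turns the sums into sums of the
same kind for the inverse.
\<close>

section \<open>Sets splitting a disjoint family\<close>

definition split_sets :: "'a set \<Rightarrow> 'a set set \<Rightarrow> nat \<Rightarrow> 'a set set" where
  "split_sets V F j = {S. S \<subseteq> V \<and> card S = j \<and> (\<forall>c\<in>F. \<not> c \<subseteq> S \<and> \<not> c \<subseteq> V - S)}"

lemma finite_split_sets: "finite V \<Longrightarrow> finite (split_sets V F j)"
  by (rule finite_subset[of _ "Pow V"]) (auto simp: split_sets_def)

text \<open>Complementation in \<open>V\<close> interchanges the two conditions imposed on a member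
  of \<open>F\<close>.\<close>

lemma card_split_sets_complement:
  assumes "finite V" "j \<le> card V"
  shows "card (split_sets V F (card V - j)) = card (split_sets V F j)"
proof (rule bij_betw_same_card[OF bij_betw_byWitness[where f = "\<lambda>S. V - S" and f' = "\<lambda>S. V - S"]])
  show "(\<lambda>S. V - S) ` split_sets V F (card V - j) \<subseteq> split_sets V F j"
    using assms by (auto simp: split_sets_def card_Diff_subset finite_subset double_diff)
  show "(\<lambda>S. V - S) ` split_sets V F j \<subseteq> split_sets V F (card V - j)"
    using assms by (auto simp: split_sets_def card_Diff_subset finite_subset double_diff)
qed (auto simp: split_sets_def)

text \<open>The one-step bound is a hypothesis because this lemma is applied to smaller families
  inside the induction that proves that bound. Past the middle the bound is iterated. An
  \<open>i\<close> before the middle is first reflected to \<open>card V - i\<close>, which is at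
  most \<open>j\<close> because \<open>card V \<le> i + j\<close>.\<close>

lemma card_split_sets_antimono:
  assumes V: "finite V"
    and step: "\<And>j. card V \<le> 2 * j + 1 \<Longrightarrow>
      (j + 1) * card (split_sets V F (j + 1)) \<le> (card V - j) * card (split_sets V F j)"
    and ij: "i \<le> j" "card V \<le> i + j"
  shows "card (split_sets V F j) \<le> card (split_sets V F i)"
proof -
  have one: "card (split_sets V F (j + 1)) \<le> card (split_sets V F j)" if j: "card V \<le> 2 * j + 1" for j
  proof -
    have "(j + 1) * card (split_sets V F (j + 1)) \<le> (card V - j) * card (split_sets V F j)"
      using step[OF j] .
    \<comment> \<open>The assumption on \<open>j\<close> says exactly that
      \<open>card V - j \<le> j + 1\<close>.\<close>
    also have "\<dots> \<le> (j + 1) * card (split_sets V F j)"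
      using j by (intro mult_right_mono) auto
    finally show ?thesis by (simp only: mult_le_cancel1)
  qed
  have chain: "card (split_sets V F j) \<le> card (split_sets V F i)"
    if "i \<le> j" "card V \<le> 2 * i + 1" for i j
    using that
  proof (induction j rule: dec_induct)
    case (step j)
    then show ?case using one[of j] by simp
  qed simp
  show ?thesis
  proof (cases "card V \<le> 2 * i + 1")
    case True
    then show ?thesis using chain ij by blast
  next
    case False
    then have "card (split_sets V F j) \<le> card (split_sets V F (card V - i))"
      using ij by (intro chain) auto
    then show ?thesis using card_split_sets_complement[OF V, of i F] False by simp
  qed
qed

text \<open>
Count pairs \<open>(S, x)\<close> with \<open>x \<in> S\<close> against pairs \<open>(T, x)\<close> with \<open>x \<notin> T\<close> via \<open>T = S - {x}\<close>. This fails for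
\<open>S\<close> if some \<open>c\<close> in the family has \<open>c \<inter> S = {x}\<close>, and for \<open>T\<close> if some \<open>c\<close> has \<open>c - T = {x}\<close>. Given \<open>c\<close>
and \<open>x\<close>, both kinds of failures correspond to splitting sets of \<open>V - c\<close>, of sizes \<open>j\<close> and
\<open>j + 1 - card c\<close>, which the induction hypothesis compares.
\<close>

lemma card_split_sets_step:
  assumes "finite V" "finite F" "disjoint F" "\<And>c. c \<in> F \<Longrightarrow> c \<subseteq> V \<and> 2 \<le> card c"
    and "card V \<le> 2 * j + 1"
  shows "(j + 1) * card (split_sets V F (j + 1)) \<le> (card V - j) * card (split_sets V F j)"
  using assms
proof (induction "card F" arbitrary: F V j rule: less_induct)
  case less
  note V = less.prems(1) and F = less.prems(2) and dis = less.prems(3) and Fc = less.prems(4)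
  let ?G = "split_sets V F"
  let ?G' = "\<lambda>c. split_sets (V - c) (F - {c})"
  have cV: "c \<subseteq> V" "finite c" "2 \<le> card c" if "c \<in> F" for c
    using Fc[OF that] V finite_subset by auto
  have disj: "c \<inter> d = {}" if "c \<in> F" "d \<in> F" "c \<noteq> d" for c d
    using dis that by (auto simp: disjoint_def)
  have fG: "finite (?G i)" for i by (rule finite_split_sets[OF V])
  have fG': "finite (?G' c i)" for c i by (rule finite_split_sets) (use V in auto)
  define A where "A = Sigma (?G (j + 1)) (\<lambda>S. S)"
  define B where "B = Sigma (?G j) (\<lambda>S. V - S)"
  define Ag where "Ag = {(S, x) \<in> A. S - {x} \<in> ?G j}"
  define Bg where "Bg = {(S, x) \<in> B. insert x S \<in> ?G (j + 1)}"
  have fS: "finite S" if "S \<in> ?G i" for S i using that V by (auto simp: split_sets_def finite_subset)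
  have fA: "finite A" unfolding A_def using fG fS by auto
  have fB: "finite B" unfolding B_def using fG V by auto
  have cA: "card A = (j + 1) * card (?G (j + 1))"
  proof -
    have "card A = (\<Sum>S\<in>?G (j + 1). card S)" unfolding A_def using fG fS by (subst card_SigmaI) auto
    also have "\<dots> = (\<Sum>S\<in>?G (j + 1). j + 1)"
      by (intro sum.cong refl) (simp add: split_sets_def)
    finally show ?thesis by simp
  qed
  have cB: "card B = (card V - j) * card (?G j)"
  proof -
    have "card B = (\<Sum>S\<in>?G j. card (V - S))" unfolding B_def using fG V by (subst card_SigmaI) auto
    also have "\<dots> = (\<Sum>S\<in>?G j. card V - j)"
      using fS by (intro sum.cong refl) (auto simp: split_sets_def card_Diff_subset)
    finally show ?thesis by simp
  qed
  have good: "card Ag \<le> card Bg"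
  proof (rule card_inj_on_le[where f = "\<lambda>(S, x). (S - {x}, x)"])
    show "inj_on (\<lambda>(S, x). (S - {x}, x)) Ag" unfolding inj_on_def Ag_def A_def by auto
    show "(\<lambda>(S, x). (S - {x}, x)) ` Ag \<subseteq> Bg"
    proof clarify
      fix S x assume a: "(S, x) \<in> Ag"
      then have "insert x (S - {x}) = S" unfolding Ag_def A_def by auto
      with a show "(S - {x}, x) \<in> Bg"
        by (auto simp: Ag_def A_def Bg_def B_def) (auto simp: split_sets_def)
    qed
    show "finite Bg" using fB unfolding Bg_def by (rule finite_subset[rotated]) auto
  qed
  let ?I = "Sigma F (\<lambda>c. c)"
  have fI: "finite ?I" using F cV by auto
  \<comment> \<open>\<open>P\<close> codes the failures for \<open>S\<close>, with
    \<open>R = S - {x}\<close> of size \<open>j\<close> inside \<open>V - c\<close>.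
    \<open>Q\<close> codes failures for \<open>T = (c - {x}) \<union> R\<close>, which has size
    \<open>j\<close> when \<open>card R = j + 1 - card c\<close>; the bound on \<open>card c\<close>
    keeps this subtraction from truncating. It suffices that \<open>P\<close> covers the first kind
    and that \<open>Q\<close> injects into the second.\<close>
  define P where "P = Sigma ?I (\<lambda>(c, x). ?G' c j)"
  define Q where "Q = Sigma (Sigma {c \<in> F. card c \<le> j + 1} (\<lambda>c. c)) (\<lambda>(c, x). ?G' c (j + 1 - card c))"
  have fP: "finite P" unfolding P_def using fI fG' by auto
  have bad1: "card (A - Ag) \<le> card P"
  proof -
    have "A - Ag \<subseteq> (\<lambda>((c, x), R). (insert x R, x)) ` P"
    proof clarify
      fix S x assume a: "(S, x) \<in> A" "(S, x) \<notin> Ag"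
      have S: "S \<in> ?G (j + 1)" "x \<in> S" "S - {x} \<notin> ?G j" using a unfolding A_def Ag_def by auto
      have "S - {x} \<subseteq> V" "card (S - {x}) = j" using S fS[OF S(1)] by (auto simp: split_sets_def)
      then obtain c where c: "c \<in> F" "c \<subseteq> S - {x} \<or> c \<subseteq> V - (S - {x})"
        using S(3) by (auto simp: split_sets_def)
      have nc: "\<not> c \<subseteq> S" "\<not> c \<subseteq> V - S" using S(1) c(1) by (auto simp: split_sets_def)
      have cS: "c \<subseteq> V - (S - {x})" using c nc by auto
      then have xc: "x \<in> c" "c \<inter> S = {x}" using nc S(2) by auto
      have "S - {x} \<in> ?G' c j"
      proof -
        have "\<not> d \<subseteq> S - {x} \<and> \<not> d \<subseteq> V - c - (S - {x})" if d: "d \<in> F - {c}" for d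
        proof -
          have dc: "d \<inter> c = {}" using disj d c by auto
          have "\<not> d \<subseteq> S \<and> \<not> d \<subseteq> V - S" using S(1) d by (auto simp: split_sets_def)
          then show ?thesis using dc xc(1) by blast
        qed
        moreover have "S - {x} \<subseteq> V - c" using S(1) xc by (auto simp: split_sets_def)
        ultimately show ?thesis using S fS[OF S(1)] by (auto simp: split_sets_def)
      qed
      then have "((c, x), S - {x}) \<in> P" using c xc unfolding P_def by auto
      moreover have "(S, x) = (\<lambda>((c, x), R). (insert x R, x)) ((c, x), S - {x})" using S by auto
      ultimately show "(S, x) \<in> (\<lambda>((c, x), R). (insert x R, x)) ` P" by blast
    qed
    then show ?thesis using fP by (meson card_image_le card_mono finite_imageI le_trans)
  qed
  have bad2: "card Q \<le> card (B - Bg)"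
  proof (rule card_inj_on_le[where f = "\<lambda>((c, x), R). ((c - {x}) \<union> R, x)"])
    show "finite (B - Bg)" using fB by auto
    show "inj_on (\<lambda>((c, x), R). (c - {x} \<union> R, x)) Q"
    proof (rule inj_onI, clarsimp)
      fix c x R d R'
      assume a: "((c, x), R) \<in> Q" "((d, x), R') \<in> Q" and eq: "c - {x} \<union> R = d - {x} \<union> R'"
      have m: "c \<in> F" "d \<in> F" "x \<in> c" "x \<in> d" "R \<subseteq> V - c" "R' \<subseteq> V - d" 
        using a unfolding Q_def by (auto simp: split_sets_def)
      then have "c = d" using disj[OF m(1,2)] by blast
      then show "c = d \<and> R = R'" using eq m by blast
    qed
    show "(\<lambda>((c, x), R). ((c - {x}) \<union> R, x)) ` Q \<subseteq> B - Bg"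
    proof
      fix y assume "y \<in> (\<lambda>((c, x), R). ((c - {x}) \<union> R, x)) ` Q"
      then obtain c x R where y: "y = ((c - {x}) \<union> R, x)" and q: "((c, x), R) \<in> Q" by auto
      then have c: "c \<in> F" "card c \<le> j + 1" "x \<in> c" and R: "R \<in> ?G' c (j + 1 - card c)"
        unfolding Q_def by auto
      have RV: "R \<subseteq> V - c" using R by (auto simp: split_sets_def)
      have fc: "finite c" "finite R" using cV[OF c(1)] finite_subset[OF RV] V by auto
      have "card ((c - {x}) \<union> R) = card (c - {x}) + card R"
        using fc RV by (intro card_Un_disjoint) auto
      also have "\<dots> = j" using fc R c cV(3)[OF c(1)] by (auto simp: split_sets_def)
      finally have cj: "card ((c - {x}) \<union> R) = j" .
      have nb: "\<not> d \<subseteq> (c - {x}) \<union> R \<and> \<not> d \<subseteq> V - ((c - {x}) \<union> R)" if d: "d \<in> F" for d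
      proof (cases "d = c")
        case True
        have "c - {x} \<noteq> {}" using cV[OF c(1)] card_mono[of "{x}" c] by auto
        then show ?thesis using True RV c by blast
      next
        case False
        have "\<not> d \<subseteq> R \<and> \<not> d \<subseteq> V - c - R" using R d False by (auto simp: split_sets_def)
        then show ?thesis using disj[OF d c(1) False] by blast
      qed
      have "(c - {x}) \<union> R \<in> ?G j" using nb cj RV cV[OF c(1)] by (auto simp: split_sets_def)
      moreover have "insert x ((c - {x}) \<union> R) \<notin> ?G (j + 1)" using c by (auto simp: split_sets_def)
      moreover have "x \<in> V - ((c - {x}) \<union> R)" using c(3) RV cV(1)[OF c(1)] by blast
      ultimately show "y \<in> B - Bg" unfolding B_def Bg_def y by simp
    qed
  qed
  have PQ: "card P \<le> card Q"
  proof -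
    \<comment> \<open>Since \<open>c\<close> has left both the ground set and the family, the
      induction hypothesis gives the one-step bound, and the size condition for \<open>V - c\<close>
      is again \<open>card V \<le> 2 * j + 1\<close>.\<close>
    have ind: "card (?G' c j) \<le> card (?G' c (j + 1 - card c))" if c: "c \<in> F" "card c \<le> j + 1" for c
    proof (rule card_split_sets_antimono)
      show "finite (V - c)" using V by auto
      have cd: "card (V - c) = card V - card c" using cV[OF c(1)] by (simp add: card_Diff_subset)
      show "j + 1 - card c \<le> j" using cV[OF c(1)] by auto
      show "card (V - c) \<le> j + 1 - card c + j" using cd less.prems(5) c by auto
      fix i assume i: "card (V - c) \<le> 2 * i + 1"
      show "(i + 1) * card (?G' c (i + 1)) \<le> (card (V - c) - i) * card (?G' c i)"
      proof (rule less.hyps[of "F - {c}" "V - c" i])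
        show "card (F - {c}) < card F" using F c by (meson card_Diff1_less)
        show "disjoint (F - {c})" using dis by (auto simp: disjoint_def)
        show "d \<subseteq> V - c \<and> 2 \<le> card d" if "d \<in> F - {c}" for d using that disj[of d c] cV[of d] c by blast
      qed (use V F i in auto)
    qed
    \<comment> \<open>The members \<open>c\<close> that \<open>Q\<close> omits: here
      \<open>V - c\<close> has fewer than \<open>j\<close> elements.\<close>
    have z: "card (?G' c j) = 0" if c: "c \<in> F" "\<not> card c \<le> j + 1" for c
    proof -
      have "card (V - c) = card V - card c" using cV[OF c(1)] by (simp add: card_Diff_subset)
      then have "card (V - c) < j" using less.prems(5) c card_mono[OF V cV(1)[OF c(1)]] by auto
      then have "\<not> (S \<subseteq> V - c \<and> card S = j)" for S using card_mono[of "V - c" S] V by auto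
      then have "?G' c j = {}" unfolding split_sets_def by blast
      then show ?thesis by simp
    qed
    have "card P = (\<Sum>(c, x)\<in>?I. card (?G' c j))" unfolding P_def using fI fG' by (subst card_SigmaI) (auto simp: case_prod_unfold)
    also have "\<dots> = (\<Sum>(c, x)\<in>Sigma {c \<in> F. card c \<le> j + 1} (\<lambda>c. c). card (?G' c j))"
    proof (intro sum.mono_neutral_right ballI)
      fix p assume "p \<in> ?I - Sigma {c \<in> F. card c \<le> j + 1} (\<lambda>c. c)"
      then obtain c x where "p = (c, x)" "c \<in> F" "\<not> card c \<le> j + 1" by auto
      then show "(case p of (c, x) \<Rightarrow> card (?G' c j)) = 0" using z by simp
    qed (use fI in auto)
    also have "\<dots> \<le> (\<Sum>(c, x)\<in>Sigma {c \<in> F. card c \<le> j + 1} (\<lambda>c. c). card (?G' c (j + 1 - card c)))"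
      using ind by (intro sum_mono) auto
    also have "\<dots> = card Q" unfolding Q_def using F cV fG' by (subst card_SigmaI) (auto simp: case_prod_unfold)
    finally show ?thesis .
  qed
  have "card A = card Ag + card (A - Ag)" using fA unfolding Ag_def
    by (subst card_Diff_subset) (auto intro!: finite_subset[OF _ fA] card_mono le_add_diff_inverse[symmetric])
  also have "\<dots> \<le> card Bg + card (B - Bg)" using good bad1 PQ bad2 by linarith
  also have "\<dots> = card B" using fB unfolding Bg_def
    by (subst card_Diff_subset) (auto intro!: finite_subset[OF _ fB] card_mono le_add_diff_inverse)
  finally show ?case unfolding cA cB .
qed

section \<open>Principal minors\<close>

text \<open>The Leibniz formula over the permutations of \<open>S\<close> itself: minors for
  different index sets can be compared without the renumbering of rows and columns done by
  \<open>submatrix\<close>.\<close>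

definition pminor :: "(nat \<Rightarrow> nat \<Rightarrow> real) \<Rightarrow> nat set \<Rightarrow> real" where
  "pminor a S = (\<Sum>\<sigma> | \<sigma> permutes S. of_int (sign \<sigma>) * (\<Prod>i\<in>S. a i (\<sigma> i)))"

lemma pminor_cong:
  assumes "\<And>i j. i \<in> S \<Longrightarrow> j \<in> S \<Longrightarrow> a i j = b i j"
  shows "pminor a S = pminor b S"
  unfolding pminor_def using assms by (intro sum.cong refl) (simp add: permutes_in_image)

lemma pminor_empty [simp]: "pminor a {} = 1"
  unfolding pminor_def by simp

text \<open>Rows outside \<open>S\<close> are unit vectors, so a permutation moving an index outside
  \<open>S\<close> contributes zero. This padding makes the determinant theory of matrices available
  for \<open>pminor\<close>.\<close>

lemma pminor_eq_det:
  assumes "S \<subseteq> {..<n}"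
  shows "pminor a S = det (mat n n (\<lambda>(i, j). if i \<in> S then a i j else if i = j then 1 else 0))"
    (is "_ = det ?M")
proof -
  have fS: "finite S" using assms finite_subset by blast
  have "pminor a S = (\<Sum>\<sigma> | \<sigma> permutes S. of_int (sign \<sigma>) * (\<Prod>i = 0..<n. ?M $$ (i, \<sigma> i)))"
    unfolding pminor_def
  proof (intro sum.cong refl arg_cong2[where f = "(*)"])
    fix \<sigma> assume "\<sigma> \<in> {\<sigma>. \<sigma> permutes S}"
    then have p: "\<sigma> permutes S" by simp
    have "\<sigma> permutes {0..<n}" using assms by (intro permutes_subset[OF p]) auto
    then have lt: "\<sigma> i < n" if "i < n" for i using permutes_in_image that by fastforce
    have "(\<Prod>i = 0..<n. ?M $$ (i, \<sigma> i)) = (\<Prod>i\<in>S. ?M $$ (i, \<sigma> i))"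
      using assms lt permutes_not_in[OF p] by (intro prod.mono_neutral_right) auto
    also have "\<dots> = (\<Prod>i\<in>S. a i (\<sigma> i))" using assms lt by (intro prod.cong) auto
    finally show "(\<Prod>i\<in>S. a i (\<sigma> i)) = (\<Prod>i = 0..<n. ?M $$ (i, \<sigma> i))" by simp
  qed
  also have "\<dots> = (\<Sum>\<sigma> | \<sigma> permutes {0..<n}. of_int (sign \<sigma>) * (\<Prod>i = 0..<n. ?M $$ (i, \<sigma> i)))"
  proof (intro sum.mono_neutral_left ballI)
    show "finite {\<sigma>. \<sigma> permutes {0..<n}}" by (simp add: finite_permutations)
    show "{\<sigma>. \<sigma> permutes S} \<subseteq> {\<sigma>. \<sigma> permutes {0..<n}}"
      using assms by (force dest: permutes_subset[of _ S "{0..<n}"])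
    fix \<sigma> assume s: "\<sigma> \<in> {\<sigma>. \<sigma> permutes {0..<n}} - {\<sigma>. \<sigma> permutes S}"
    then obtain i where i: "i < n" "i \<notin> S" "\<sigma> i \<noteq> i"
      using permutes_superset[of \<sigma> "{0..<n}" S] by auto
    moreover have "\<sigma> i < n" using s i(1) permutes_in_image[of \<sigma> "{0..<n}" i] by auto
    ultimately have "(\<Prod>i = 0..<n. ?M $$ (i, \<sigma> i)) = 0" by (intro prod_zero bexI[of _ i]) auto
    then show "of_int (sign \<sigma>) * (\<Prod>i = 0..<n. ?M $$ (i, \<sigma> i)) = 0" by simp
  qed
  also have "\<dots> = det ?M" by (simp add: det_def'[of _ n])
  finally show ?thesis .
qed

text \<open>The map \<open>pick S\<close> is a bijection from the positions onto \<open>S\<close>;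
  conjugation with it carries permutations to permutations and preserves signs.\<close>

lemma principal_minor_eq_pminor:
  assumes "A \<in> carrier_mat n n" "S \<subseteq> {..<n}"
  shows "principal_minor A S = pminor (\<lambda>i j. A $$ (i, j)) S"
proof -
  have S: "finite S" using assms(2) finite_subset by blast
  define c where "c = card S"
  have "{i. i < n \<and> i \<in> S} = S" using assms(2) by auto
  then have sub: "submatrix A S S = mat c c (\<lambda>(i, j). A $$ (pick S i, pick S j))"
    using assms(1) by (simp add: submatrix_def c_def)
  have inj: "inj_on (pick S) {0..<c}"
    unfolding inj_on_def c_def
    by (metis atLeastLessThan_iff linorder_neqE_nat nat_neq_iff pick_mono_le)
  have "pick S ` {0..<c} = S"
  proof (rule card_subset_eq[OF S])
    show "pick S ` {0..<c} \<subseteq> S" using pick_in_set_le by (auto simp: c_def)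
    show "card (pick S ` {0..<c}) = card S" using inj by (simp add: card_image c_def)
  qed
  then have bij: "bij_betw (pick S) {0..<c} S" using inj by (simp add: bij_betw_def)
  have perm: "\<sigma> i < c" if "\<sigma> permutes {0..<c}" "i < c" for \<sigma> i
    using permutes_in_image[OF that(1)] that(2) by fastforce
  have "principal_minor A S = 
    (\<Sum>\<sigma> | \<sigma> permutes {0..<c}. of_int (sign \<sigma>) * (\<Prod>i = 0..<c. A $$ (pick S i, pick S (\<sigma> i))))"
    unfolding principal_minor_def sub
    by (subst det_def'[of _ c]) (auto intro!: sum.cong prod.cong simp: perm)
  also have "\<dots> = (\<Sum>\<sigma> | \<sigma> permutes S. of_int (sign \<sigma>) * (\<Prod>i\<in>S. A $$ (i, \<sigma> i)))"
  proof (rule sum.reindex_bij_witness[where j = "map_permutation {0..<c} (pick S)"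
        and i = "map_permutation S (inv_into {0..<c} (pick S))"])
    fix \<sigma> assume "\<sigma> \<in> {\<sigma>. \<sigma> permutes {0..<c}}"
    then have p: "\<sigma> permutes {0..<c}" by simp
    show "map_permutation S (inv_into {0..<c} (pick S)) (map_permutation {0..<c} (pick S) \<sigma>) = \<sigma>"
      using bij p by (rule map_permutation_compose_inv) (simp add: bij_betw_inv_into_left[OF bij])
    show "map_permutation {0..<c} (pick S) \<sigma> \<in> {\<sigma>. \<sigma> permutes S}"
      using map_permutation_permutes[OF bij p] by simp
    have "(\<Prod>i\<in>S. A $$ (i, map_permutation {0..<c} (pick S) \<sigma> i)) =
      (\<Prod>i = 0..<c. A $$ (pick S i, pick S (\<sigma> i)))"
      using inj p by (subst prod.reindex_bij_betw[OF bij, symmetric])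
        (auto intro!: prod.cong simp: map_permutation_apply)
    then show "of_int (sign (map_permutation {0..<c} (pick S) \<sigma>)) *
        (\<Prod>i\<in>S. A $$ (i, map_permutation {0..<c} (pick S) \<sigma> i)) =
      of_int (sign \<sigma>) * (\<Prod>i = 0..<c. A $$ (pick S i, pick S (\<sigma> i)))"
      using inj p by (subst sign_map_permutation) auto
  next
    fix \<sigma> assume "\<sigma> \<in> {\<sigma>. \<sigma> permutes S}"
    then have p: "\<sigma> permutes S" by simp
    show "map_permutation {0..<c} (pick S) (map_permutation S (inv_into {0..<c} (pick S)) \<sigma>) = \<sigma>"
      using bij_betw_inv_into[OF bij] p
      by (rule map_permutation_compose_inv) (simp add: bij_betw_inv_into_right[OF bij])
    show "map_permutation S (inv_into {0..<c} (pick S)) \<sigma> \<in> {\<sigma>. \<sigma> permutes {0..<c}}"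
      using map_permutation_permutes[OF bij_betw_inv_into[OF bij] p] by simp
  qed
  also have "\<dots> = pminor (\<lambda>i j. A $$ (i, j)) S" unfolding pminor_def ..
  finally show ?thesis .
qed

section \<open>Jacobi's identity, dependent rows and Schur complements\<close>

text \<open>Take \<open>X\<close> with the rows of \<open>B\<close> outside \<open>S\<close> and
  unit rows on \<open>S\<close>. Then \<open>X * A\<close> has the rows of \<open>A\<close> on
  \<open>S\<close> and, because \<open>B * A\<close> is the identity, unit rows elsewhere. Comparing
  determinants gives the identity.\<close>

lemma pminor_jacobi:
  assumes A: "A \<in> carrier_mat n n" and B: "B \<in> carrier_mat n n" and BA: "B * A = 1\<^sub>m n"
    and S: "S \<subseteq> {..<n}"
  shows "pminor (\<lambda>i j. A $$ (i, j)) S = pminor (\<lambda>i j. B $$ (i, j)) ({..<n} - S) * det A"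
proof -
  define X where "X = mat n n (\<lambda>(i, j). if i \<in> {..<n} - S then B $$ (i, j) else if i = j then 1 else 0)"
  have X: "X \<in> carrier_mat n n" unfolding X_def by simp
  have "X * A = mat n n (\<lambda>(i, j). if i \<in> S then A $$ (i, j) else if i = j then 1 else 0)"
  proof (rule eq_matI, goal_cases)
    case (1 i j)
    then have ij: "i < n" "j < n" by auto
    have "(X * A) $$ (i, j) = (\<Sum>l = 0..<n. X $$ (i, l) * A $$ (l, j))"
      using ij X A by (simp add: scalar_prod_def)
    also have "\<dots> = (if i \<in> S then A $$ (i, j) else if i = j then 1 else 0)"
    proof (cases "i \<in> S")
      case True
      then have "(\<Sum>l = 0..<n. X $$ (i, l) * A $$ (l, j)) = (\<Sum>l = 0..<n. if i = l then A $$ (l, j) else 0)"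
        using ij by (intro sum.cong) (auto simp: X_def)
      then show ?thesis using ij True by simp
    next
      case False
      then have "(\<Sum>l = 0..<n. X $$ (i, l) * A $$ (l, j)) = (\<Sum>l = 0..<n. B $$ (i, l) * A $$ (l, j))"
        using ij by (intro sum.cong) (auto simp: X_def)
      also have "\<dots> = (B * A) $$ (i, j)" using ij B A by (simp add: scalar_prod_def)
      finally show ?thesis using ij False by (simp add: BA)
    qed
    finally show ?case using ij by simp
  qed (use X A in auto)
  then have "pminor (\<lambda>i j. A $$ (i, j)) S = det (X * A)" using pminor_eq_det[OF S] by simp
  also have "\<dots> = det X * det A" using X A by (rule det_mult)
  also have "det X = pminor (\<lambda>i j. B $$ (i, j)) ({..<n} - S)"
    unfolding X_def by (subst pminor_eq_det[of _ n]) auto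
  finally show ?thesis .
qed

text \<open>The indicator vector of \<open>c\<close> is a nonzero left null vector of the padded
  matrix.\<close>

lemma pminor_dependent:
  assumes S: "finite S" and c: "c \<subseteq> S" "c \<noteq> {}" and z: "\<And>j. j \<in> S \<Longrightarrow> (\<Sum>i\<in>c. a i j) = 0"
  shows "pminor a S = 0"
proof -
  obtain n where n: "S \<subseteq> {..<n}" using S finite_nat_iff_bounded by auto
  \<comment> \<open>The column sums are controlled only for columns in \<open>S\<close>; clearing
    the other columns leaves the minor unchanged and makes the null vector work on all
    columns.\<close>
  define b where "b = (\<lambda>i j. if j \<in> S then a i j else 0)"
  define M where "M = mat n n (\<lambda>(i, j). if i \<in> S then b i j else if i = j then 1 else 0)"
  have M: "M \<in> carrier_mat n n" unfolding M_def by simp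
  define v :: "real vec" where "v = vec n (\<lambda>i. if i \<in> c then 1 else 0)"
  have "M\<^sup>T *\<^sub>v v = 0\<^sub>v n"
  proof (rule eq_vecI)
    fix j assume "j < dim_vec (0\<^sub>v n)"
    then have j: "j < n" by simp
    have "(M\<^sup>T *\<^sub>v v) $ j = (\<Sum>i = 0..<n. M $$ (i, j) * v $ i)"
      using j M by (simp add: scalar_prod_def v_def)
    also have "\<dots> = (\<Sum>i\<in>c. M $$ (i, j) * v $ i)"
      using n c by (intro sum.mono_neutral_right) (auto simp: v_def)
    also have "\<dots> = (\<Sum>i\<in>c. b i j)"
      proof (intro sum.cong refl)
      fix i assume i: "i \<in> c"
      then have "i \<in> S" "i < n" using c n by auto
      then show "M $$ (i, j) * v $ i = b i j" using i j by (simp add: v_def M_def)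
    qed
    also have "\<dots> = 0" using z by (cases "j \<in> S") (simp_all add: b_def)
    finally show "(M\<^sup>T *\<^sub>v v) $ j = 0\<^sub>v n $ j" using j by simp
  qed (use M in auto)
  moreover have "v \<noteq> 0\<^sub>v n"
  proof
    obtain i where i: "i \<in> c" using c by auto
    assume "v = 0\<^sub>v n"
    then have "v $ i = 0" using i c n by auto
    then show False using i c n by (auto simp: v_def split: if_splits)
  qed
  moreover have "v \<in> carrier_vec n" unfolding v_def by simp
  moreover have "M\<^sup>T \<in> carrier_mat n n" using M by simp
  ultimately have "det (M\<^sup>T) = 0" using det_0_iff_vec_prod_zero[of "M\<^sup>T" n] by blast
  then have "det M = 0" using det_transpose[OF M] by simp
  moreover have "pminor a S = pminor b S" by (rule pminor_cong) (simp add: b_def)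
  ultimately show ?thesis using pminor_eq_det[OF n, of b] by (simp add: M_def)
qed

text \<open>A permutation moving \<open>i\<close> sends some \<open>j\<close> in \<open>S\<close> to
  \<open>i\<close> and so picks up the factor \<open>a j i = 0\<close>; only permutations of
  \<open>S\<close> remain.\<close>

lemma pminor_insert_zero_column:
  assumes S: "finite S" "i \<notin> S" and z: "\<And>j. j \<in> S \<Longrightarrow> a j i = 0"
  shows "pminor a (insert i S) = a i i * pminor a S"
proof -
  have "pminor a (insert i S) = 
    (\<Sum>\<sigma> | \<sigma> permutes S. of_int (sign \<sigma>) * (\<Prod>j\<in>insert i S. a j (\<sigma> j)))"
    unfolding pminor_def
  proof (rule sum.mono_neutral_right)
    show "finite {\<sigma>. \<sigma> permutes insert i S}" using S by (simp add: finite_permutations)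
    show "{\<sigma>. \<sigma> permutes S} \<subseteq> {\<sigma>. \<sigma> permutes insert i S}" by (auto dest: permutes_subset[of _ S "insert i S"])
    show "\<forall>\<sigma>\<in>{\<sigma>. \<sigma> permutes insert i S} - {\<sigma>. \<sigma> permutes S}.
       of_int (sign \<sigma>) * (\<Prod>j\<in>insert i S. a j (\<sigma> j)) = 0"
    proof
      fix \<sigma> assume s: "\<sigma> \<in> {\<sigma>. \<sigma> permutes insert i S} - {\<sigma>. \<sigma> permutes S}"
      then have p: "\<sigma> permutes insert i S" by simp
      have ii: "\<sigma> i \<noteq> i" using s permutes_superset[OF p, of S] by auto
      obtain j where j: "\<sigma> j = i" using permutes_surj[OF p] by (metis surjD)
      then have "j \<in> insert i S" using permutes_in_image[OF p] by (metis insertI1)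
      then have jS: "j \<in> S" using j ii by auto
      then have "(\<Prod>j\<in>insert i S. a j (\<sigma> j)) = 0"
        using j z S by (intro prod_zero) auto
      then show "of_int (sign \<sigma>) * (\<Prod>j\<in>insert i S. a j (\<sigma> j)) = 0" by simp
    qed
  qed
  also have "\<dots> = (\<Sum>\<sigma> | \<sigma> permutes S. a i i * (of_int (sign \<sigma>) * (\<Prod>j\<in>S. a j (\<sigma> j))))"
    using S by (intro sum.cong) (auto simp: permutes_not_in)
  finally show ?thesis unfolding pminor_def by (simp add: sum_distrib_left)
qed

definition schur :: "(nat \<Rightarrow> nat \<Rightarrow> real) \<Rightarrow> nat \<Rightarrow> nat \<Rightarrow> nat \<Rightarrow> real" where
  "schur a i j k = a j k - a j i * a i k / a i i"

text \<open>Gaussian elimination written as \<open>L * U = M\<close>. On the rows of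
  \<open>S\<close>, \<open>U\<close> has the entries of \<open>schur a i\<close>, whose column
  \<open>i\<close> is zero, and \<open>L\<close> carries the multipliers
  \<open>a j i / a i i\<close> in column \<open>i\<close>. As \<open>i\<close> is not in
  \<open>S\<close>, the minor of \<open>L\<close> on \<open>S\<close> is that of the
  identity.\<close>

lemma pminor_insert_pivot:
  assumes S: "finite S" "i \<notin> S" and nz: "a i i \<noteq> 0"
  shows "pminor a (insert i S) = a i i * pminor (schur a i) S"
proof -
  obtain n where n: "insert i S \<subseteq> {..<n}" using S finite_nat_iff_bounded by (meson finite_insert)
  define u where "u = (\<lambda>j k. if j \<in> S then schur a i j k else a j k)"
  define M where "M = mat n n (\<lambda>(j, k). if j \<in> insert i S then a j k else if j = k then 1 else 0)"
  define U where "U = mat n n (\<lambda>(j, k). if j \<in> insert i S then u j k else if j = k then 1 else 0)"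
  define l where "l = (\<lambda>j k. if j = k then 1 else if k = i then a j i / a i i else 0)"
  define L where "L = mat n n (\<lambda>(j, k). if j \<in> S then l j k else if j = k then 1 else 0)"
  have car: "M \<in> carrier_mat n n" "U \<in> carrier_mat n n" "L \<in> carrier_mat n n"
    unfolding M_def U_def L_def by auto
  have "L * U = M"
  proof (rule eq_matI, goal_cases)
    case (1 j k)
    then have jk: "j < n" "k < n" using car by auto
    have inn: "i < n" "i \<noteq> j \<or> j \<notin> S" using n S by auto
    have "(L * U) $$ (j, k) = (\<Sum>t = 0..<n. L $$ (j, t) * U $$ (t, k))"
      using jk car by (simp add: scalar_prod_def)
    also have "\<dots> = (\<Sum>t = 0..<n. (if t = j then U $$ (j, k) else 0) +
        (if t = i then (if j \<in> S then a j i / a i i * U $$ (i, k) else 0) else 0))"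
      using jk inn by (intro sum.cong) (auto simp: L_def l_def)
    also have "\<dots> = U $$ (j, k) + (if j \<in> S then a j i / a i i * U $$ (i, k) else 0)"
      using jk inn by (simp add: sum.distrib)
    also have "\<dots> = M $$ (j, k)"
      using jk inn S by (auto simp: U_def M_def u_def schur_def)
    finally show ?case .
  qed (use car in auto)
  then have "det M = det L * det U" using det_mult[OF car(3,2)] by simp
  moreover have "det M = pminor a (insert i S)" using pminor_eq_det[OF n] by (simp add: M_def)
  moreover have "det U = pminor u (insert i S)" using pminor_eq_det[OF n] by (simp add: U_def)
  moreover have "pminor u (insert i S) = u i i * pminor u S"
    using S nz by (intro pminor_insert_zero_column) (auto simp: u_def schur_def)
  moreover have "pminor u S = pminor (schur a i) S" by (rule pminor_cong) (simp add: u_def)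
  moreover have "det L = 1"
  proof -
    have Sn: "S \<subseteq> {..<n}" using n by auto
    have "det L = pminor l S" unfolding L_def using pminor_eq_det[OF Sn] by simp
    also have "\<dots> = pminor (\<lambda>j k. if j = k then 1 else 0) S"
      using S by (intro pminor_cong) (auto simp: l_def)
    also have "\<dots> = det (1\<^sub>m n)" unfolding pminor_eq_det[OF Sn]
      by (intro arg_cong[where f = det] eq_matI) auto
    finally show ?thesis by simp
  qed
  ultimately show ?thesis using S by (simp add: u_def)
qed

section \<open>Scaling, diagonal perturbation and row expansion\<close>

lemma pminor_singleton [simp]: "pminor a {i} = a i i"
  unfolding pminor_def by simp

lemma pminor_scale_columns:
  assumes "finite S"
  shows "pminor (\<lambda>i j. a i j * x j) S = pminor a S * prod x S"
  unfolding pminor_def sum_distrib_right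
proof (intro sum.cong refl)
  fix \<sigma> assume "\<sigma> \<in> {\<sigma>. \<sigma> permutes S}"
  then have "prod (\<lambda>i. x (\<sigma> i)) S = prod x S"
    using prod.permute[of \<sigma> S x] by (simp add: o_def)
  then show "of_int (sign \<sigma>) * (\<Prod>i\<in>S. a i (\<sigma> i) * x (\<sigma> i)) =
    of_int (sign \<sigma>) * (\<Prod>i\<in>S. a i (\<sigma> i)) * prod x S"
    by (simp add: prod.distrib)
qed

text \<open>Multiplying out each Leibniz product, \<open>T\<close> is the set of rows where the
  entry of \<open>a\<close> is chosen. The diagonal factors on \<open>S - T\<close> vanish unless
  the permutation fixes all of \<open>S - T\<close>.\<close>

lemma pminor_add_diagonal:
  assumes S: "finite S"
  shows "pminor (\<lambda>i j. a i j + (if i = j then e else 0)) S = 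
    (\<Sum>T\<in>Pow S. pminor a T * e ^ card (S - T))"
proof -
  let ?d = "\<lambda>i j. if i = j then e else (0::real)"
  have "pminor (\<lambda>i j. a i j + ?d i j) S = 
    (\<Sum>\<sigma> | \<sigma> permutes S. \<Sum>T\<in>Pow S. of_int (sign \<sigma>) * ((\<Prod>i\<in>T. a i (\<sigma> i)) * (\<Prod>i\<in>S - T. ?d i (\<sigma> i))))"
    unfolding pminor_def by (simp only: prod_add[OF S] sum_distrib_left)
  also have "\<dots> = (\<Sum>T\<in>Pow S. \<Sum>\<sigma> | \<sigma> permutes S. of_int (sign \<sigma>) * ((\<Prod>i\<in>T. a i (\<sigma> i)) * (\<Prod>i\<in>S - T. ?d i (\<sigma> i))))"
    by (rule sum.swap)
  also have "\<dots> = (\<Sum>T\<in>Pow S. pminor a T * e ^ card (S - T))"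
  proof (intro sum.cong refl)
    fix T assume "T \<in> Pow S"
    then have T: "T \<subseteq> S" "finite T" using S finite_subset by auto
    have "(\<Sum>\<sigma> | \<sigma> permutes S. of_int (sign \<sigma>) * ((\<Prod>i\<in>T. a i (\<sigma> i)) * (\<Prod>i\<in>S - T. ?d i (\<sigma> i))))
       = (\<Sum>\<sigma> | \<sigma> permutes T. of_int (sign \<sigma>) * ((\<Prod>i\<in>T. a i (\<sigma> i)) * (\<Prod>i\<in>S - T. ?d i (\<sigma> i))))"
    proof (rule sum.mono_neutral_right)
      show "finite {\<sigma>. \<sigma> permutes S}" using S by (simp add: finite_permutations)
      show "{\<sigma>. \<sigma> permutes T} \<subseteq> {\<sigma>. \<sigma> permutes S}" using T by (auto dest: permutes_subset[of _ T S])
      show "\<forall>\<sigma>\<in>{\<sigma>. \<sigma> permutes S} - {\<sigma>. \<sigma> permutes T}.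
         of_int (sign \<sigma>) * ((\<Prod>i\<in>T. a i (\<sigma> i)) * (\<Prod>i\<in>S - T. ?d i (\<sigma> i))) = 0"
      proof
        fix \<sigma> assume s: "\<sigma> \<in> {\<sigma>. \<sigma> permutes S} - {\<sigma>. \<sigma> permutes T}"
        then obtain i where i: "i \<in> S - T" "\<sigma> i \<noteq> i"
          using permutes_superset[of \<sigma> S T] by auto
        then have "\<exists>i\<in>S - T. ?d i (\<sigma> i) = 0" by metis
        then have "(\<Prod>i\<in>S - T. ?d i (\<sigma> i)) = 0" using S by (intro prod_zero finite_Diff)
        then show "of_int (sign \<sigma>) * ((\<Prod>i\<in>T. a i (\<sigma> i)) * (\<Prod>i\<in>S - T. ?d i (\<sigma> i))) = 0" by simp
      qed
    qed
    also have "\<dots> = (\<Sum>\<sigma> | \<sigma> permutes T. of_int (sign \<sigma>) * (\<Prod>i\<in>T. a i (\<sigma> i)) * e ^ card (S - T))"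
      by (intro sum.cong refl) (auto simp: permutes_not_in)
    finally show "(\<Sum>\<sigma> | \<sigma> permutes S. of_int (sign \<sigma>) * ((\<Prod>i\<in>T. a i (\<sigma> i)) * (\<Prod>i\<in>S - T. ?d i (\<sigma> i))))
       = pminor a T * e ^ card (S - T)"
      unfolding pminor_def sum_distrib_right .
  qed
  finally show ?thesis .
qed

text \<open>Multilinearity in the rows; \<open>f\<close> records which summand is chosen in each
  row.\<close>

lemma pminor_sum_rows:
  assumes S: "finite S" and T: "\<And>i. i \<in> S \<Longrightarrow> finite (T i)"
    and a: "\<And>i j. i \<in> S \<Longrightarrow> j \<in> S \<Longrightarrow> a i j = (\<Sum>t\<in>T i. w i t * b i t j)"
  shows "pminor a S = (\<Sum>f\<in>PiE S T. (\<Prod>i\<in>S. w i (f i)) * pminor (\<lambda>i. b i (f i)) S)"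
proof -
  have "pminor a S = (\<Sum>\<sigma> | \<sigma> permutes S. of_int (sign \<sigma>) * (\<Prod>i\<in>S. \<Sum>t\<in>T i. w i t * b i t (\<sigma> i)))"
    unfolding pminor_def using a by (intro sum.cong refl) (simp add: permutes_in_image)
  also have "\<dots> = (\<Sum>\<sigma> | \<sigma> permutes S. \<Sum>f\<in>PiE S T.
      of_int (sign \<sigma>) * (\<Prod>i\<in>S. w i (f i) * b i (f i) (\<sigma> i)))"
    using S T by (simp add: prod_sum_PiE sum_distrib_left)
  also have "\<dots> = (\<Sum>f\<in>PiE S T. \<Sum>\<sigma> | \<sigma> permutes S.
      of_int (sign \<sigma>) * (\<Prod>i\<in>S. w i (f i) * b i (f i) (\<sigma> i)))"
    by (rule sum.swap)
  also have "\<dots> = (\<Sum>f\<in>PiE S T. (\<Prod>i\<in>S. w i (f i)) * pminor (\<lambda>i. b i (f i)) S)"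
    unfolding pminor_def sum_distrib_left prod.distrib by (intro sum.cong refl) simp
  finally show ?thesis .
qed

section \<open>M-matrices and functional graphs\<close>

text \<open>Strict positivity is required of every principal minor, so that all pivots are positive
  and the class passes to principal submatrices and Schur complements.\<close>

definition nonsing_M :: "(nat \<Rightarrow> nat \<Rightarrow> real) \<Rightarrow> nat set \<Rightarrow> bool" where
  "nonsing_M a V \<longleftrightarrow> (\<forall>i\<in>V. \<forall>j\<in>V. i \<noteq> j \<longrightarrow> a i j \<le> 0) \<and> (\<forall>S\<subseteq>V. 0 < pminor a S)"

lemma nonsing_M_diagonal: "nonsing_M a V \<Longrightarrow> i \<in> V \<Longrightarrow> 0 < a i i"
  unfolding nonsing_M_def using pminor_singleton by (metis empty_subsetI insert_subset)

text \<open>Off the diagonal, the subtracted term is a product of two nonpositive entries over a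
  positive pivot. The minors are quotients of those of \<open>a\<close> by that pivot.\<close>

lemma nonsing_M_schur:
  assumes "finite V" "i \<notin> V" "nonsing_M a (insert i V)"
  shows "nonsing_M (schur a i) V"
proof -
  have d: "0 < a i i" using nonsing_M_diagonal assms(3) by blast
  have "schur a i j k \<le> 0" if jk: "j \<in> V" "k \<in> V" "j \<noteq> k" for j k
  proof -
    have "a j k \<le> 0" "a j i \<le> 0" "a i k \<le> 0"
      using assms jk unfolding nonsing_M_def by (metis insertI1 insertI2)+
    moreover from this have "0 \<le> a j i * a i k / a i i"
      using d by (simp add: mult_nonpos_nonpos)
    ultimately show ?thesis unfolding schur_def by simp
  qed
  moreover have "0 < pminor (schur a i) S" if S: "S \<subseteq> V" for S
  proof -
    have "0 < pminor a (insert i S)"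
      using assms(3) S unfolding nonsing_M_def by (meson insert_mono)
    moreover have "pminor a (insert i S) = a i i * pminor (schur a i) S"
      using assms S d finite_subset by (intro pminor_insert_pivot) auto
    ultimately show ?thesis using d by (simp add: zero_less_mult_iff)
  qed
  ultimately show ?thesis unfolding nonsing_M_def by auto
qed

text \<open>This \<open>x\<close> is the column scaling that makes all row sums positive. Induction
  eliminates \<open>i\<close>: from a solution \<open>y\<close> for the Schur complement,
  \<open>x i\<close> is chosen so that row \<open>i\<close> takes a small value
  \<open>e > 0\<close>. The other rows then differ from their Schur values by
  \<open>a j i * e / a i i\<close>, which is harmless for small \<open>e\<close>.\<close>

lemma nonsing_M_semipositive:
  assumes "finite V" "nonsing_M a V"
  shows "\<exists>x. \<forall>i\<in>V. 0 < x i \<and> 0 < (\<Sum>j\<in>V. a i j * x j)"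
  using assms
proof (induction V arbitrary: a rule: finite_induct)
  case (insert i V)
  have d: "0 < a i i" using nonsing_M_diagonal insert.prems by blast
  obtain y where y: "\<And>j. j \<in> V \<Longrightarrow> 0 < y j" "\<And>j. j \<in> V \<Longrightarrow> 0 < (\<Sum>k\<in>V. schur a i j k * y k)"
    using insert.IH[OF nonsing_M_schur[OF insert.hyps insert.prems]] by blast
  have "\<forall>\<^sub>F e in at_right 0. 0 < (\<Sum>k\<in>V. schur a i j k * y k) + a j i * e / a i i" if j: "j \<in> V" for j
  proof (rule order_tendstoD(1)[OF _ y(2)[OF j]])
    show "((\<lambda>e. (\<Sum>k\<in>V. schur a i j k * y k) + a j i * e / a i i) \<longlongrightarrow>
        (\<Sum>k\<in>V. schur a i j k * y k)) (at_right 0)"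
      using d by (auto intro!: tendsto_eq_intros)
  qed
  then have "\<forall>\<^sub>F e in at_right (0::real). \<forall>j\<in>V. 0 < (\<Sum>k\<in>V. schur a i j k * y k) + a j i * e / a i i"
    using insert.hyps by (simp add: eventually_ball_finite_distrib)
  then have "\<forall>\<^sub>F e in at_right (0::real). (\<forall>j\<in>V. 0 < (\<Sum>k\<in>V. schur a i j k * y k) + a j i * e / a i i) \<and> 0 < e"
    by (intro eventually_conj eventually_at_right_less)
  then obtain e where e: "0 < e" "\<And>j. j \<in> V \<Longrightarrow> 0 < (\<Sum>k\<in>V. schur a i j k * y k) + a j i * e / a i i"
    using eventually_happens[of _ "at_right (0::real)"] by fastforce
  define x where "x = y(i := (e - (\<Sum>k\<in>V. a i k * y k)) / a i i)"
  have xV: "x j = y j" if "j \<in> V" for j using that insert.hyps unfolding x_def by auto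
  have sx: "(\<Sum>k\<in>insert i V. a j k * x k) = a j i * x i + (\<Sum>k\<in>V. a j k * y k)" for j
    using insert.hyps xV by simp
  have row: "(\<Sum>k\<in>insert i V. a j k * x k) = (\<Sum>k\<in>V. schur a i j k * y k) + a j i * e / a i i" for j
  proof -
    have "(\<Sum>k\<in>V. schur a i j k * y k) = (\<Sum>k\<in>V. a j k * y k) - a j i / a i i * (\<Sum>k\<in>V. a i k * y k)"
      unfolding schur_def by (simp add: algebra_simps sum_subtractf sum_distrib_left)
    then show ?thesis unfolding sx using d by (simp add: x_def field_simps)
  qed
  \<comment> \<open>The off-diagonal signs are needed here, to make \<open>x i\<close>
    positive.\<close>
  have "(\<Sum>k\<in>V. a i k * y k) \<le> 0"
  proof (rule sum_nonpos)
    fix k assume k: "k \<in> V"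
    then have "a i k \<le> 0" using insert.prems insert.hyps unfolding nonsing_M_def by (metis insertI1 insertI2)
    then show "a i k * y k \<le> 0" using y(1)[OF k] by (simp add: mult_nonpos_nonneg)
  qed
  then have xi: "0 < x i" using e d unfolding x_def by simp
  have "0 < (\<Sum>k\<in>insert i V. a i k * x k)"
    unfolding sx using d e by (simp add: x_def)
  then show ?case using xi xV y e row insert.hyps by (intro exI[of _ x]) (metis insert_iff)
qed simp

section \<open>Cycles of functional graphs and forest expansions\<close>

text \<open>On a finite set, being mapped onto itself means being permuted, that is, being a union
  of cycles. The map \<open>f\<close> may lead out of \<open>S\<close>.\<close>

definition acyclic_on :: "(nat \<Rightarrow> nat) \<Rightarrow> nat set \<Rightarrow> bool" where
  "acyclic_on f S \<longleftrightarrow> (\<forall>c\<subseteq>S. f ` c = c \<longrightarrow> c = {})"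

lemma acyclic_on_cong: "(\<And>i. i \<in> S \<Longrightarrow> f i = g i) \<Longrightarrow> acyclic_on f S = acyclic_on g S"
  unfolding acyclic_on_def by (metis image_cong subsetD)

text \<open>If \<open>f\<close> permutes a nonempty \<open>c\<close> inside \<open>S\<close>, the
  rows indexed by \<open>c\<close> sum to zero. Otherwise a permutation other than \<open>id\<close>
  with a nonzero term would agree with \<open>f\<close> on the points it moves, and these would form
  such a \<open>c\<close>; the term of \<open>id\<close> is 1 because \<open>f\<close> has no fixed
  point in \<open>S\<close>.\<close>

lemma pminor_functional_graph:
  assumes S: "finite S"
  shows "pminor (\<lambda>i j. of_bool (i = j) - of_bool (f i = j)) S = of_bool (acyclic_on f S)"
proof (cases "acyclic_on f S")
  case False
  then obtain c where c: "c \<subseteq> S" "f ` c = c" "c \<noteq> {}" unfolding acyclic_on_def by metis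
  then have fc: "finite c" using S finite_subset by blast
  have inj: "inj_on f c" using c(2) fc by (intro eq_card_imp_inj_on) auto
  have "pminor (\<lambda>i j. of_bool (i = j) - of_bool (f i = j)) S = 0"
  proof (rule pminor_dependent[OF S c(1,3)])
    fix j
    have "(\<Sum>i\<in>c. of_bool (f i = j)) = (\<Sum>k\<in>c. of_bool (k = j) :: real)"
      using sum.reindex[OF inj, of "\<lambda>k. of_bool (k = j) :: real"] c(2) by simp
    then show "(\<Sum>i\<in>c. of_bool (i = j) - of_bool (f i = j)) = (0::real)"
      by (simp add: sum_subtractf)
  qed
  then show ?thesis using False by simp
next
  case True
  let ?b = "\<lambda>i j. of_bool (i = j) - of_bool (f i = j) :: real"
  have nofix: "f i \<noteq> i" if "i \<in> S" for i
    using True that unfolding acyclic_on_def by (metis empty_subsetI image_empty image_insert insert_not_empty insert_subset)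
  have "pminor ?b S = (\<Sum>\<sigma>\<in>{id}. of_int (sign \<sigma>) * (\<Prod>i\<in>S. ?b i (\<sigma> i)))"
    unfolding pminor_def
  proof (rule sum.mono_neutral_right)
    show "finite {\<sigma>. \<sigma> permutes S}" using S by (simp add: finite_permutations)
    show "{id} \<subseteq> {\<sigma>. \<sigma> permutes S}" by (simp add: permutes_id)
    show "\<forall>\<sigma>\<in>{\<sigma>. \<sigma> permutes S} - {id}. of_int (sign \<sigma>) * (\<Prod>i\<in>S. ?b i (\<sigma> i)) = 0"
    proof
      fix \<sigma> assume s: "\<sigma> \<in> {\<sigma>. \<sigma> permutes S} - {id}"
      then have p: "\<sigma> permutes S" "\<sigma> \<noteq> id" by auto
      define c where "c = {i. \<sigma> i \<noteq> i}"
      have cS: "c \<subseteq> S" using permutes_not_in[OF p(1)] unfolding c_def by blast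
      have cn: "c \<noteq> {}" using p(2) unfolding c_def by (auto simp: fun_eq_iff)
      have sc: "\<sigma> ` c = c"
      proof
        show "\<sigma> ` c \<subseteq> c" using permutes_inj[OF p(1)] unfolding c_def by (auto dest: injD)
        show "c \<subseteq> \<sigma> ` c"
        proof
          fix j assume j: "j \<in> c"
          obtain i where "j = \<sigma> i" using permutes_surj[OF p(1)] by (metis surjD)
          then show "j \<in> \<sigma> ` c" using j unfolding c_def by auto
        qed
      qed
      have "\<exists>i\<in>S. ?b i (\<sigma> i) = 0"
      proof (rule ccontr)
        assume "\<not> ?thesis"
        then have b: "?b i (\<sigma> i) \<noteq> 0" if "i \<in> S" for i using that by blast
        have "f i = \<sigma> i" if "i \<in> c" for i
        proof (rule ccontr)
          assume "f i \<noteq> \<sigma> i"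
          moreover have "i \<in> S" "i \<noteq> \<sigma> i" using that cS unfolding c_def by auto
          ultimately show False using b[of i] by simp
        qed
        then have "f ` c = c" using sc by (metis image_cong)
        then show False using True cS cn unfolding acyclic_on_def by blast
      qed
      then have "(\<Prod>i\<in>S. ?b i (\<sigma> i)) = 0" using S by (intro prod_zero)
      then show "of_int (sign \<sigma>) * (\<Prod>i\<in>S. ?b i (\<sigma> i)) = 0" by simp
    qed
  qed
  also have "\<dots> = 1" using nofix by simp
  finally show ?thesis using True by simp
qed

text \<open>
On a minimal nonempty \<open>c\<close> with \<open>f ` c = c\<close>, the map \<open>f\<close> is a single cycle; working with
minimality avoids paths and orbits altogether.
\<close>

definition min_cycles :: "(nat \<Rightarrow> nat) \<Rightarrow> nat set \<Rightarrow> nat set set" where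
  "min_cycles f V = {c. c \<subseteq> V \<and> c \<noteq> {} \<and> f ` c = c \<and> (\<forall>d\<subseteq>c. f ` d = d \<longrightarrow> d \<noteq> {} \<longrightarrow> d = c)}"

text \<open>By finiteness, every nonempty set that \<open>f\<close> maps onto itself contains a
  minimal one.\<close>

lemma acyclic_on_iff_min_cycles:
  assumes "finite V" "S \<subseteq> V"
  shows "acyclic_on f S \<longleftrightarrow> (\<forall>c\<in>min_cycles f V. \<not> c \<subseteq> S)"
proof
  assume L: "acyclic_on f S"
  show "\<forall>c\<in>min_cycles f V. \<not> c \<subseteq> S"
  proof
    fix c assume "c \<in> min_cycles f V"
    then have "f ` c = c" "c \<noteq> {}" unfolding min_cycles_def by simp_all
    then show "\<not> c \<subseteq> S" using L unfolding acyclic_on_def by metis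
  qed
next
  assume R: "\<forall>c\<in>min_cycles f V. \<not> c \<subseteq> S"
  show "acyclic_on f S"
  proof (rule ccontr)
    assume "\<not> ?thesis"
    then obtain c where c: "c \<subseteq> S" "f ` c = c" "c \<noteq> {}" unfolding acyclic_on_def by metis
    let ?D = "{d. d \<subseteq> c \<and> f ` d = d \<and> d \<noteq> {}}"
    have "finite ?D" using c(1) assms by (intro finite_subset[of ?D "Pow V"]) auto
    moreover have "c \<in> ?D" using c by simp
    ultimately have "\<exists>d\<in>?D. d \<le> c \<and> (\<forall>e\<in>?D. e \<le> d \<longrightarrow> d = e)"
      by (rule finite_has_minimal2)
    then obtain d where d: "d \<in> ?D" "\<forall>e\<in>?D. e \<le> d \<longrightarrow> d = e" by (elim bexE conjE)
    have dV: "d \<subseteq> V" "d \<subseteq> S" using d(1) c(1) assms(2) by auto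
    have "e = d" if "e \<subseteq> d" "f ` e = e" "e \<noteq> {}" for e
    proof -
      have "e \<in> ?D" using that d(1) subset_trans[of e d c] by simp
      then have "d = e" using d(2) that(1) by simp
      then show ?thesis by simp
    qed
    then have "d \<in> min_cycles f V" using d(1) dV unfolding min_cycles_def by simp
    then show False using R dV by blast
  qed
qed

text \<open>As \<open>f\<close> is injective on \<open>c\<close>, it maps
  \<open>c \<inter> d\<close> onto itself; if this set is nonempty, minimality identifies it with
  both \<open>c\<close> and \<open>d\<close>.\<close>

lemma disjoint_min_cycles:
  assumes V: "finite V"
  shows "disjoint (min_cycles f V)"
  unfolding disjoint_def
proof (intro ballI impI, rule ccontr)
  fix c d assume c: "c \<in> min_cycles f V" and d: "d \<in> min_cycles f V" "c \<noteq> d" and ne: "c \<inter> d \<noteq> {}"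
  have f: "finite c" "f ` c = c" "f ` d = d" using c d V finite_subset unfolding min_cycles_def by auto
  have "inj_on f c" using f by (intro eq_card_imp_inj_on) auto
  then have "card (f ` (c \<inter> d)) = card (c \<inter> d)" by (intro card_image) (auto simp: inj_on_def)
  moreover have "f ` (c \<inter> d) \<subseteq> c \<inter> d" using image_Int_subset[of f c d] f by simp
  ultimately have "f ` (c \<inter> d) = c \<inter> d" using f(1) by (intro card_subset_eq) auto
  then have "c \<inter> d = c" "c \<inter> d = d"
    using c d(1) ne Int_lower1[of c d] Int_lower2[of c d] unfolding min_cycles_def by simp_all
  then show False using d by simp
qed

text \<open>The index \<open>z\<close> outside \<open>V\<close> is the root: its column is not part of any minor, so \<open>t = z\<close> gives \<open>e_i\<close>.\<close>

lemma pminor_forest_expansion: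
  assumes V: "finite V" "z \<notin> V" and S: "S \<subseteq> V"
    and w: "\<And>i j. i \<in> V \<Longrightarrow> w i j = (if j = z then \<Sum>k\<in>V. b i k else - b i j)"
  shows "pminor b S = (\<Sum>f\<in>PiE S (\<lambda>i. insert z V - {i}). (\<Prod>i\<in>S. w i (f i)) * of_bool (acyclic_on f S))"
proof -
  have fS: "finite S" using S V finite_subset by blast
  have "pminor b S = (\<Sum>f\<in>PiE S (\<lambda>i. insert z V - {i}).
      (\<Prod>i\<in>S. w i (f i)) * pminor (\<lambda>i j. of_bool (i = j) - of_bool (f i = j)) S)"
  proof (rule pminor_sum_rows[OF fS])
    show "finite (insert z V - {i})" for i using V by simp
    fix i j assume "i \<in> S" "j \<in> S"
    then have i: "i \<in> V" and j: "j \<in> V" using S by auto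
    have iz: "insert z V - {i} = insert z (V - {i})" using V i by auto
    \<comment> \<open>The root carries the row sum, so the weights of row \<open>i\<close> total the
      coefficient of \<open>e_i\<close>. This sum runs over \<open>V\<close> rather than
      \<open>S\<close>, so that \<open>S\<close> and \<open>V - S\<close> share the same
      weights.\<close>
    have tot: "(\<Sum>t\<in>insert z V - {i}. w i t) = b i i"
    proof -
      have "(\<Sum>t\<in>insert z V - {i}. w i t) = (\<Sum>k\<in>V. b i k) + (\<Sum>t\<in>V - {i}. - b i t)"
        unfolding iz using V i by (auto simp: w intro!: sum.cong split: if_splits)
      also have "\<dots> = b i i" using V i by (simp add: sum.remove[of V i] sum_negf)
      finally show ?thesis .
    qed
    show "b i j = (\<Sum>t\<in>insert z V - {i}. w i t * (of_bool (i = j) - of_bool (t = j)))"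
    proof (cases "i = j")
      case True
      then have "(\<Sum>t\<in>insert z V - {i}. w i t * (of_bool (i = j) - of_bool (t = j))) = (\<Sum>t\<in>insert z V - {i}. w i t)"
        by (intro sum.cong) auto
      then show ?thesis using tot True by simp
    next
      case False
      have "(\<Sum>t\<in>insert z V - {i}. w i t * (of_bool (i = j) - of_bool (t = j))) =
        (\<Sum>t\<in>insert z V - {i}. if t = j then - w i t else 0)"
        using False by (intro sum.cong) auto
      also have "\<dots> = - w i j" using V j False by simp
      also have "\<dots> = b i j" using w[OF i] j V by auto
      finally show ?thesis by simp
    qed
  qed
  then show ?thesis using fS by (simp add: pminor_functional_graph)
qed

text \<open>A map on \<open>V\<close> is a pair of maps on \<open>S\<close> and
  \<open>V - S\<close>; the hypotheses say that \<open>g\<close> and \<open>h\<close> each see only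
  one of the two.\<close>

lemma sum_PiE_split:
  fixes g h :: "('a \<Rightarrow> 'b) \<Rightarrow> real"
  assumes S: "S \<subseteq> V"
    and g: "\<And>p q. (\<And>i. i \<in> S \<Longrightarrow> p i = q i) \<Longrightarrow> g p = g q"
    and h: "\<And>p q. (\<And>i. i \<in> V - S \<Longrightarrow> p i = q i) \<Longrightarrow> h p = h q"
  shows "(\<Sum>f\<in>PiE S T. g f) * (\<Sum>f\<in>PiE (V - S) T. h f) = (\<Sum>f\<in>PiE V T. g f * h f)"
  unfolding sum_product sum.cartesian_product
proof (rule sum.reindex_bij_witness[where j = "\<lambda>(p, q) i. if i \<in> S then p i else q i"
      and i = "\<lambda>f. (restrict f S, restrict f (V - S))"])
  fix a assume "a \<in> PiE S T \<times> PiE (V - S) T"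
  then obtain p q where a: "a = (p, q)" "p \<in> PiE S T" "q \<in> PiE (V - S) T" by auto
  show "(restrict (case a of (p, q) \<Rightarrow> \<lambda>i. if i \<in> S then p i else q i) S,
      restrict (case a of (p, q) \<Rightarrow> \<lambda>i. if i \<in> S then p i else q i) (V - S)) = a"
    using a by (auto simp: fun_eq_iff restrict_def PiE_def extensional_def)
  show "(case a of (p, q) \<Rightarrow> \<lambda>i. if i \<in> S then p i else q i) \<in> PiE V T"
    using a S by (auto simp: PiE_def extensional_def Pi_def)
  have "g (\<lambda>i. if i \<in> S then p i else q i) = g p" by (rule g) simp
  moreover have "h (\<lambda>i. if i \<in> S then p i else q i) = h q" by (rule h) simp
  ultimately show "g (case a of (p, q) \<Rightarrow> \<lambda>i. if i \<in> S then p i else q i) *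
      h (case a of (p, q) \<Rightarrow> \<lambda>i. if i \<in> S then p i else q i) = (case a of (p, q) \<Rightarrow> g p * h q)"
    using a by simp
next
  fix f assume f: "f \<in> PiE V T"
  show "(case (restrict f S, restrict f (V - S)) of (p, q) \<Rightarrow> \<lambda>i. if i \<in> S then p i else q i) = f"
    using f S by (auto simp: fun_eq_iff restrict_def PiE_def extensional_def)
  show "(restrict f S, restrict f (V - S)) \<in> PiE S T \<times> PiE (V - S) T"
    using f S by (auto simp: PiE_def Pi_def)
qed

section \<open>The inequality for sums over complementary minors\<close>

definition split_sum :: "(nat \<Rightarrow> nat \<Rightarrow> real) \<Rightarrow> nat set \<Rightarrow> nat \<Rightarrow> real" where
  "split_sum a V j = (\<Sum>S | S \<subseteq> V \<and> card S = j. pminor a S * pminor a (V - S))"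

text \<open>The expansions of the two complementary minors combine into one sum over maps
  \<open>f\<close> on \<open>V\<close>, in which \<open>S\<close> counts exactly when it splits
  every minimal cycle of \<open>f\<close>. Exchanging the sums counts these \<open>S\<close> for
  each \<open>f\<close>.\<close>

lemma split_sum_forest_expansion:
  assumes V: "finite V" "z \<notin> V"
    and w: "\<And>i j. i \<in> V \<Longrightarrow> w i j = (if j = z then \<Sum>k\<in>V. b i k else - b i j)"
  shows "split_sum b V j = (\<Sum>f\<in>PiE V (\<lambda>i. insert z V - {i}).
      (\<Prod>i\<in>V. w i (f i)) * card (split_sets V (min_cycles f V) j))"
proof -
  let ?T = "\<lambda>i. insert z V - {i}"
  let ?X = "{S. S \<subseteq> V \<and> card S = j}"
  have fX: "finite ?X" using V by (intro finite_subset[of ?X "Pow V"]) auto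
  have forest: "pminor b S = (\<Sum>f\<in>PiE S ?T. (\<Prod>i\<in>S. w i (f i)) * of_bool (acyclic_on f S))"
    if "S \<subseteq> V" for S
    by (rule pminor_forest_expansion[OF V that]) (rule w)
  have "pminor b S * pminor b (V - S) =
      (\<Sum>f\<in>PiE V ?T. (\<Prod>i\<in>V. w i (f i)) * of_bool (S \<in> split_sets V (min_cycles f V) j))" if S: "S \<in> ?X" for S
  proof -
    have SV: "S \<subseteq> V" using S by simp
    have "pminor b S * pminor b (V - S) =
      (\<Sum>f\<in>PiE V ?T. ((\<Prod>i\<in>S. w i (f i)) * of_bool (acyclic_on f S)) *
        ((\<Prod>i\<in>V - S. w i (f i)) * of_bool (acyclic_on f (V - S))))"
      unfolding forest[OF SV] forest[OF Diff_subset]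
    proof (rule sum_PiE_split[OF SV])
      fix p q :: "nat \<Rightarrow> nat"
      show "(\<Prod>i\<in>S. w i (p i)) * of_bool (acyclic_on p S) = (\<Prod>i\<in>S. w i (q i)) * of_bool (acyclic_on q S)"
        if "\<And>i. i \<in> S \<Longrightarrow> p i = q i"
        using that acyclic_on_cong[of S p q] by simp
      show "(\<Prod>i\<in>V - S. w i (p i)) * of_bool (acyclic_on p (V - S)) = (\<Prod>i\<in>V - S. w i (q i)) * of_bool (acyclic_on q (V - S))"
        if "\<And>i. i \<in> V - S \<Longrightarrow> p i = q i"
        using that acyclic_on_cong[of "V - S" p q] by simp
    qed
    also have "\<dots> = (\<Sum>f\<in>PiE V ?T. (\<Prod>i\<in>V. w i (f i)) * of_bool (S \<in> split_sets V (min_cycles f V) j))"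
    proof (rule sum.cong[OF refl])
      fix f
      have "(\<Prod>i\<in>V. w i (f i)) = (\<Prod>i\<in>V - S. w i (f i)) * (\<Prod>i\<in>S. w i (f i))"
        using SV V by (intro prod.subset_diff) auto
      moreover have "S \<in> split_sets V (min_cycles f V) j \<longleftrightarrow> acyclic_on f S \<and> acyclic_on f (V - S)"
        using S unfolding acyclic_on_iff_min_cycles[OF V(1) SV]
          acyclic_on_iff_min_cycles[OF V(1) Diff_subset] split_sets_def
        by (simp add: ball_conj_distrib)
      ultimately show "((\<Prod>i\<in>S. w i (f i)) * of_bool (acyclic_on f S)) *
        ((\<Prod>i\<in>V - S. w i (f i)) * of_bool (acyclic_on f (V - S))) =
        (\<Prod>i\<in>V. w i (f i)) * of_bool (S \<in> split_sets V (min_cycles f V) j)" by simp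
    qed
    finally show ?thesis .
  qed
  then have "split_sum b V j = (\<Sum>S\<in>?X. \<Sum>f\<in>PiE V ?T. (\<Prod>i\<in>V. w i (f i)) * of_bool (S \<in> split_sets V (min_cycles f V) j))"
    unfolding split_sum_def by (rule sum.cong[OF refl])
  also have "\<dots> = (\<Sum>f\<in>PiE V ?T. \<Sum>S\<in>?X. (\<Prod>i\<in>V. w i (f i)) * of_bool (S \<in> split_sets V (min_cycles f V) j))"
    by (rule sum.swap)
  also have "\<dots> = (\<Sum>f\<in>PiE V ?T. (\<Prod>i\<in>V. w i (f i)) * card (split_sets V (min_cycles f V) j))"
  proof (rule sum.cong[OF refl])
    fix f
    have "?X \<inter> split_sets V (min_cycles f V) j = split_sets V (min_cycles f V) j"
      unfolding split_sets_def by auto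
    then show "(\<Sum>S\<in>?X. (\<Prod>i\<in>V. w i (f i)) * of_bool (S \<in> split_sets V (min_cycles f V) j)) =
        (\<Prod>i\<in>V. w i (f i)) * card (split_sets V (min_cycles f V) j)"
      using fX by (simp add: sum_distrib_left[symmetric] sum_of_bool_eq Int_def)
  qed
  finally show ?thesis .
qed

text \<open>The sign pattern and the row sums make all weights nonnegative, so the counting
  inequality can be applied to each \<open>f\<close> separately.\<close>

lemma split_sum_step_dominant:
  assumes V: "finite V"
    and Z: "\<And>i j. i \<in> V \<Longrightarrow> j \<in> V \<Longrightarrow> i \<noteq> j \<Longrightarrow> b i j \<le> 0"
    and dom: "\<And>i. i \<in> V \<Longrightarrow> 0 \<le> (\<Sum>j\<in>V. b i j)"
    and j: "card V \<le> 2 * j + 1"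
  shows "real (j + 1) * split_sum b V (j + 1) \<le> real (card V - j) * split_sum b V j"
proof -
  obtain z where z: "z \<notin> V" using V ex_new_if_finite infinite_UNIV_nat by metis
  define w where "w = (\<lambda>i j. if j = z then \<Sum>k\<in>V. b i k else - b i j)"
  have expand: "split_sum b V j = (\<Sum>f\<in>PiE V (\<lambda>i. insert z V - {i}).
      (\<Prod>i\<in>V. w i (f i)) * card (split_sets V (min_cycles f V) j))" for j
    by (rule split_sum_forest_expansion[OF V z]) (simp add: w_def)
  show ?thesis
    unfolding expand sum_distrib_left
  proof (rule sum_mono)
    fix f assume f: "f \<in> PiE V (\<lambda>i. insert z V - {i})"
    let ?c = "\<lambda>j. card (split_sets V (min_cycles f V) j)"
    have "(j + 1) * ?c (j + 1) \<le> (card V - j) * ?c j"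
    proof (rule card_split_sets_step[OF V _ disjoint_min_cycles[OF V] _ j])
      show "finite (min_cycles f V)" using V
        by (intro finite_subset[of "min_cycles f V" "Pow V"]) (auto simp: min_cycles_def)
      fix c assume c: "c \<in> min_cycles f V"
      have cV: "c \<subseteq> V" "finite c" "c \<noteq> {}" "f ` c = c"
        using c V finite_subset unfolding min_cycles_def by auto
      \<comment> \<open>The expansion excludes \<open>f i = i\<close>, so no cycle is a
        loop.\<close>
      have "card c \<noteq> 1"
      proof
        assume "card c = 1"
        then obtain i where "c = {i}" by (auto simp: card_1_singleton_iff)
        then have "i \<in> V" "f i = i" using cV by auto
        then show False using f by (auto simp: PiE_def Pi_def)
      qed
      moreover have "card c \<noteq> 0" using cV by simp
      ultimately have "2 \<le> card c" by linarith
      then show "c \<subseteq> V \<and> 2 \<le> card c" using cV(1) by blast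
    qed
    then have "real (j + 1) * real (?c (j + 1)) \<le> real (card V - j) * real (?c j)"
      by (metis of_nat_le_iff of_nat_mult)
    moreover have "0 \<le> (\<Prod>i\<in>V. w i (f i))"
    proof (rule prod_nonneg)
      fix i assume i: "i \<in> V"
      then have "f i \<in> insert z V - {i}" using f by (auto simp: PiE_def Pi_def)
      then show "0 \<le> w i (f i)" using dom[OF i] Z[OF i, of "f i"] unfolding w_def by auto
    qed
    ultimately show "real (j + 1) * ((\<Prod>i\<in>V. w i (f i)) * real (?c (j + 1))) \<le>
        real (card V - j) * ((\<Prod>i\<in>V. w i (f i)) * real (?c j))"
      by (metis mult.left_commute mult_left_mono)
  qed
qed

text \<open>Since \<open>S\<close> and \<open>V - S\<close> together use every column once, scaling
  the columns multiplies every term by the same positive factor \<open>prod x V\<close>. This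
  reduces the claim to nonnegative row sums.\<close>

lemma split_sum_step:
  assumes V: "finite V" and M: "nonsing_M a V" and j: "card V \<le> 2 * j + 1"
  shows "real (j + 1) * split_sum a V (j + 1) \<le> real (card V - j) * split_sum a V j"
proof -
  obtain x where x: "\<And>i. i \<in> V \<Longrightarrow> 0 < x i" "\<And>i. i \<in> V \<Longrightarrow> 0 < (\<Sum>j\<in>V. a i j * x j)"
    using nonsing_M_semipositive[OF V M] by blast
  let ?b = "\<lambda>i j. a i j * x j"
  have pos: "0 < prod x V" using x(1) by (intro prod_pos)
  have scale: "split_sum ?b V j = prod x V * split_sum a V j" for j
    unfolding split_sum_def sum_distrib_left
  proof (rule sum.cong[OF refl])
    fix S assume "S \<in> {S. S \<subseteq> V \<and> card S = j}"
    then have S: "S \<subseteq> V" "finite S" using V finite_subset by auto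
    have "prod x V = prod x (V - S) * prod x S" using S V by (intro prod.subset_diff)
    then show "pminor ?b S * pminor ?b (V - S) = prod x V * (pminor a S * pminor a (V - S))"
      using S V by (simp add: pminor_scale_columns)
  qed
  have "real (j + 1) * split_sum ?b V (j + 1) \<le> real (card V - j) * split_sum ?b V j"
  proof (rule split_sum_step_dominant[OF V _ _ j])
    show "?b i j \<le> 0" if "i \<in> V" "j \<in> V" "i \<noteq> j" for i j
      using M that x(1)[of j] unfolding nonsing_M_def by (simp add: mult_nonpos_nonneg)
    show "0 \<le> (\<Sum>j\<in>V. ?b i j)" if "i \<in> V" for i using x(2)[OF that] by simp
  qed
  then have "prod x V * (real (j + 1) * split_sum a V (j + 1)) \<le> prod x V * (real (card V - j) * split_sum a V j)"
    unfolding scale by (simp only: mult.left_commute)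
  then show ?thesis using pos by (simp only: mult_le_cancel_left_pos)
qed

section \<open>Sums of products of minors\<close>

text \<open>Eliminating the elements of \<open>G\<close> one at a time yields \<open>c\<close> as
  the Schur complement of the block \<open>G\<close>.\<close>

lemma nonsing_M_schur_set:
  assumes "finite G" "finite U" "G \<inter> U = {}" "nonsing_M a (G \<union> U)"
  shows "\<exists>c. nonsing_M c U \<and> (\<forall>S\<subseteq>U. pminor a (G \<union> S) = pminor a G * pminor c S)"
  using assms
proof (induction G arbitrary: a rule: finite_induct)
  case (insert i G)
  have d: "a i i \<noteq> 0" using nonsing_M_diagonal[OF insert.prems(3), of i] by simp
  have "nonsing_M (schur a i) (G \<union> U)"
    using insert by (intro nonsing_M_schur) auto
  then obtain c where c: "nonsing_M c U"
    "\<And>S. S \<subseteq> U \<Longrightarrow> pminor (schur a i) (G \<union> S) = pminor (schur a i) G * pminor c S"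
    using insert.IH[of "schur a i"] insert.prems by auto
  have "pminor a (insert i G \<union> S) = pminor a (insert i G) * pminor c S" if S: "S \<subseteq> U" for S
  proof -
    have "pminor a (insert i (G \<union> S)) = a i i * pminor (schur a i) (G \<union> S)"
      using insert.prems insert.hyps S d finite_subset[OF S] by (intro pminor_insert_pivot) auto
    moreover have "pminor a (insert i G) = a i i * pminor (schur a i) G"
      using insert.hyps d by (intro pminor_insert_pivot) auto
    ultimately show ?thesis using c(2)[OF S] by simp
  qed
  then show ?case using c(1) by blast
qed auto

section \<open>Grouping pairs by intersection and symmetric difference\<close>

definition index_pairs :: "nat \<Rightarrow> nat \<Rightarrow> nat \<Rightarrow> nat \<Rightarrow> (nat set \<times> nat set) set" where
  "index_pairs n m1 m2 k = {(\<alpha>, \<beta>). \<alpha> \<subseteq> {..<n} \<and> \<beta> \<subseteq> {..<n} \<and>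
     card \<alpha> = m1 \<and> card \<beta> = m2 \<and> card (\<alpha> \<inter> \<beta>) = k}"

text \<open>The pairs \<open>(\<alpha> \<inter> \<beta>, (\<alpha> \<union> \<beta>) - (\<alpha> \<inter> \<beta>))\<close>.\<close>

definition core_pairs :: "nat \<Rightarrow> nat \<Rightarrow> nat \<Rightarrow> (nat set \<times> nat set) set" where
  "core_pairs n k q = {(\<gamma>, W). \<gamma> \<subseteq> {..<n} \<and> W \<subseteq> {..<n} - \<gamma> \<and> card \<gamma> = k \<and> card W = q}"

lemma finite_core_pairs: "finite (core_pairs n k q)"
  by (rule finite_subset[of _ "Pow {..<n} \<times> Pow {..<n}"]) (auto simp: core_pairs_def)

lemma minor_sum_eq_pminor:
  assumes "A \<in> carrier_mat n n"
  shows "minor_sum m1 m2 k A = (\<Sum>(\<alpha>, \<beta>)\<in>index_pairs n m1 m2 k.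
    pminor (\<lambda>i j. A $$ (i, j)) \<alpha> * pminor (\<lambda>i j. A $$ (i, j)) \<beta>)"
  unfolding minor_sum_def index_pairs_def using assms
  by (intro sum.cong) (auto simp: principal_minor_eq_pminor)

text \<open>The remaining coordinate of a pair is \<open>S = \<alpha> - \<beta>\<close>. The outer
  index set depends on \<open>m1\<close> and \<open>m2\<close> only through their sum, so the sizes
  \<open>(m, m)\<close> and \<open>(m + 1, m - 1)\<close> share it.\<close>

lemma sum_index_pairs:
  fixes F :: "nat set \<Rightarrow> nat set \<Rightarrow> real"
  assumes "k \<le> m1" "k \<le> m2"
  shows "(\<Sum>(\<alpha>, \<beta>)\<in>index_pairs n m1 m2 k. F \<alpha> \<beta>) =
    (\<Sum>(\<gamma>, W)\<in>core_pairs n k (m1 + m2 - 2 * k). \<Sum>S | S \<subseteq> W \<and> card S = m1 - k. F (\<gamma> \<union> S) (\<gamma> \<union> (W - S)))"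
proof -
  let ?X = "core_pairs n k (m1 + m2 - 2 * k)"
  let ?Y = "\<lambda>(\<gamma>, W). {S. S \<subseteq> W \<and> card S = m1 - k}"
  have fY: "finite (?Y p)" if "p \<in> ?X" for p
  proof -
    obtain \<gamma> W where p: "p = (\<gamma>, W)" by (cases p)
    then have "finite W" using that finite_subset[of W "{..<n} - \<gamma>"] by (auto simp: core_pairs_def)
    then show ?thesis unfolding p by (auto intro: finite_subset[of _ "Pow W"])
  qed
  have "(\<Sum>p\<in>?X. \<Sum>S\<in>?Y p. F (fst p \<union> S) (fst p \<union> (snd p - S))) =
    (\<Sum>(p, S)\<in>Sigma ?X ?Y. F (fst p \<union> S) (fst p \<union> (snd p - S)))"
    using fY by (intro sum.Sigma finite_core_pairs) blast
  also have "\<dots> = (\<Sum>(\<alpha>, \<beta>)\<in>index_pairs n m1 m2 k. F \<alpha> \<beta>)"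
  proof (rule sum.reindex_bij_witness[symmetric,
        where j = "\<lambda>(\<alpha>, \<beta>). ((\<alpha> \<inter> \<beta>, \<alpha> \<union> \<beta> - \<alpha> \<inter> \<beta>), \<alpha> - \<beta>)"
          and i = "\<lambda>((\<gamma>, W), S). (\<gamma> \<union> S, \<gamma> \<union> (W - S))"])
    fix q assume "q \<in> index_pairs n m1 m2 k"
    then obtain \<alpha> \<beta> where q: "q = (\<alpha>, \<beta>)" "\<alpha> \<subseteq> {..<n}" "\<beta> \<subseteq> {..<n}"
      "card \<alpha> = m1" "card \<beta> = m2" "card (\<alpha> \<inter> \<beta>) = k" by (auto simp: index_pairs_def)
    have f: "finite \<alpha>" "finite \<beta>" using q finite_subset by blast+
    have "card (\<alpha> \<union> \<beta>) + k = m1 + m2" using card_Un_Int[OF f] q by simp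
    moreover have "card (\<alpha> \<union> \<beta> - \<alpha> \<inter> \<beta>) = card (\<alpha> \<union> \<beta>) - k"
      using f q by (subst card_Diff_subset) auto
    moreover have "card (\<alpha> - \<beta>) = m1 - k" using f q by (simp add: card_Diff_subset_Int)
    ultimately show "(case q of (\<alpha>, \<beta>) \<Rightarrow> ((\<alpha> \<inter> \<beta>, \<alpha> \<union> \<beta> - \<alpha> \<inter> \<beta>), \<alpha> - \<beta>)) \<in> Sigma ?X ?Y"
      using q by (auto simp: core_pairs_def)
    have e: "\<alpha> \<inter> \<beta> \<union> (\<alpha> - \<beta>) = \<alpha>" "\<alpha> \<inter> \<beta> \<union> (\<alpha> \<union> \<beta> - \<alpha> \<inter> \<beta> - (\<alpha> - \<beta>)) = \<beta>" by auto
    show "(\<lambda>((\<gamma>, W), S). (\<gamma> \<union> S, \<gamma> \<union> (W - S))) ((\<lambda>(\<alpha>, \<beta>). ((\<alpha> \<inter> \<beta>, \<alpha> \<union> \<beta> - \<alpha> \<inter> \<beta>), \<alpha> - \<beta>)) q) = q"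
      using q e by simp
    show "(case case q of (\<alpha>, \<beta>) \<Rightarrow> ((\<alpha> \<inter> \<beta>, \<alpha> \<union> \<beta> - \<alpha> \<inter> \<beta>), \<alpha> - \<beta>) of
        (p, S) \<Rightarrow> F (fst p \<union> S) (fst p \<union> (snd p - S))) = (case q of (\<alpha>, \<beta>) \<Rightarrow> F \<alpha> \<beta>)"
      using q e by simp
  next
    fix q assume "q \<in> Sigma ?X ?Y"
    then obtain \<gamma> W S where q: "q = ((\<gamma>, W), S)" "\<gamma> \<subseteq> {..<n}" "W \<subseteq> {..<n} - \<gamma>"
      "card \<gamma> = k" "card W = m1 + m2 - 2 * k" "S \<subseteq> W" "card S = m1 - k"
      by (auto simp: core_pairs_def)
    have f: "finite \<gamma>" "finite W" "finite S"
      using q finite_subset[of \<gamma> "{..<n}"] finite_subset[of W "{..<n} - \<gamma>"] finite_subset[of S W] by auto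
    have e: "(\<gamma> \<union> S) \<inter> (\<gamma> \<union> (W - S)) = \<gamma>" "(\<gamma> \<union> S) \<union> (\<gamma> \<union> (W - S)) - \<gamma> = W"
      "(\<gamma> \<union> S) - (\<gamma> \<union> (W - S)) = S" using q by auto
    then show "(\<lambda>(\<alpha>, \<beta>). ((\<alpha> \<inter> \<beta>, \<alpha> \<union> \<beta> - \<alpha> \<inter> \<beta>), \<alpha> - \<beta>)) ((\<lambda>((\<gamma>, W), S). (\<gamma> \<union> S, \<gamma> \<union> (W - S))) q) = q"
      using q by simp
    have "card (\<gamma> \<union> S) = k + (m1 - k)" using q f by (subst card_Un_disjoint) auto
    moreover have "card (\<gamma> \<union> (W - S)) = k + card (W - S)" using q f by (subst card_Un_disjoint) auto
    moreover have "card (W - S) = m2 - k" using q f assms by (simp add: card_Diff_subset)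
    ultimately show "(\<lambda>((\<gamma>, W), S). (\<gamma> \<union> S, \<gamma> \<union> (W - S))) q \<in> index_pairs n m1 m2 k"
      using q assms e(1) by (auto simp: index_pairs_def)
  qed
  finally show ?thesis by (simp add: case_prod_unfold)
qed

text \<open>For fixed \<open>\<gamma>\<close> and \<open>W\<close>, the Schur complement of
  \<open>\<gamma>\<close> extracts the common factor \<open>(pminor a \<gamma>)\<^sup>2\<close>.
  What remains is \<open>split_sum_step\<close> on \<open>W\<close> with
  \<open>card W = 2 * (m - k)\<close>, at its middle size.\<close>

lemma pair_sum_step_nonsing:
  assumes M: "nonsing_M a {..<n}" and k: "k < m"
  shows "real (m - k + 1) * (\<Sum>(\<alpha>, \<beta>)\<in>index_pairs n (m + 1) (m - 1) k. pminor a \<alpha> * pminor a \<beta>) \<le>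
    real (m - k) * (\<Sum>(\<alpha>, \<beta>)\<in>index_pairs n m m k. pminor a \<alpha> * pminor a \<beta>)"
proof -
  let ?p = "m - k"
  have q: "m + 1 + (m - 1) - 2 * k = 2 * ?p" "m + m - 2 * k = 2 * ?p" "m + 1 - k = ?p + 1"
    using k by auto
  let ?f = "\<lambda>\<gamma> W s. \<Sum>S | S \<subseteq> W \<and> card S = s. pminor a (\<gamma> \<union> S) * pminor a (\<gamma> \<union> (W - S))"
  have "real (?p + 1) * ?f \<gamma> W (?p + 1) \<le> real ?p * ?f \<gamma> W ?p"
    if "(\<gamma>, W) \<in> core_pairs n k (2 * ?p)" for \<gamma> W
  proof -
    have c: "\<gamma> \<subseteq> {..<n}" "W \<subseteq> {..<n}" "\<gamma> \<inter> W = {}" "card W = 2 * ?p"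
      using that by (auto simp: core_pairs_def)
    have f: "finite \<gamma>" "finite W" using c finite_subset by blast+
    have "nonsing_M a (\<gamma> \<union> W)" using M c unfolding nonsing_M_def by (meson Un_least subsetD subset_trans)
    then obtain b where b: "nonsing_M b W"
      "\<And>S. S \<subseteq> W \<Longrightarrow> pminor a (\<gamma> \<union> S) = pminor a \<gamma> * pminor b S"
      using nonsing_M_schur_set[OF f c(3)] by blast
    have fs: "?f \<gamma> W s = (pminor a \<gamma>)\<^sup>2 * split_sum b W s" for s
      unfolding split_sum_def sum_distrib_left
      by (intro sum.cong refl) (simp add: b(2) power2_eq_square)
    have "real (?p + 1) * split_sum b W (?p + 1) \<le> real ?p * split_sum b W ?p"
      using split_sum_step[OF f(2) b(1), of ?p] c(4) by simp
    then have "(pminor a \<gamma>)\<^sup>2 * (real (?p + 1) * split_sum b W (?p + 1)) \<le>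
        (pminor a \<gamma>)\<^sup>2 * (real ?p * split_sum b W ?p)"
      by (intro mult_left_mono) auto
    then show ?thesis unfolding fs by (simp only: mult.left_commute)
  qed
  then have "real (?p + 1) * (\<Sum>(\<gamma>, W)\<in>core_pairs n k (2 * ?p). ?f \<gamma> W (?p + 1)) \<le>
      real ?p * (\<Sum>(\<gamma>, W)\<in>core_pairs n k (2 * ?p). ?f \<gamma> W ?p)"
    unfolding sum_distrib_left by (intro sum_mono) (simp add: case_prod_unfold sum_distrib_left)
  moreover have "(\<Sum>(\<alpha>, \<beta>)\<in>index_pairs n (m + 1) (m - 1) k. pminor a \<alpha> * pminor a \<beta>) =
      (\<Sum>(\<gamma>, W)\<in>core_pairs n k (2 * ?p). ?f \<gamma> W (?p + 1))"
    using k sum_index_pairs[of k "m + 1" "m - 1" "\<lambda>\<alpha> \<beta>. pminor a \<alpha> * pminor a \<beta>" n]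
    unfolding q by simp
  moreover have "(\<Sum>(\<alpha>, \<beta>)\<in>index_pairs n m m k. pminor a \<alpha> * pminor a \<beta>) =
      (\<Sum>(\<gamma>, W)\<in>core_pairs n k (2 * ?p). ?f \<gamma> W ?p)"
    using k sum_index_pairs[of k m m "\<lambda>\<alpha> \<beta>. pminor a \<alpha> * pminor a \<beta>" n]
    unfolding q by simp
  ultimately show ?thesis by simp
qed

section \<open>From nonsingular to arbitrary M-matrices\<close>

text \<open>In the expansion by powers of \<open>e\<close> all terms are nonnegative, and the term
  for the empty set is a positive power of \<open>e\<close>.\<close>

lemma nonsing_M_add_diagonal:
  assumes V: "finite V" and Z: "\<And>i j. i \<in> V \<Longrightarrow> j \<in> V \<Longrightarrow> i \<noteq> j \<Longrightarrow> a i j \<le> 0"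
    and P: "\<And>S. S \<subseteq> V \<Longrightarrow> 0 \<le> pminor a S" and e: "0 < e"
  shows "nonsing_M (\<lambda>i j. a i j + (if i = j then e else 0)) V"
proof -
  have "0 < pminor (\<lambda>i j. a i j + (if i = j then e else 0)) S" if S: "S \<subseteq> V" for S
  proof -
    have fS: "finite S" using S V finite_subset by blast
    show ?thesis
      unfolding pminor_add_diagonal[OF fS]
    proof (rule sum_pos2)
      show "finite (Pow S)" "{} \<in> Pow S" using fS by auto
      show "0 < pminor a {} * e ^ card (S - {})" using e by simp
      show "0 \<le> pminor a T * e ^ card (S - T)" if "T \<in> Pow S" for T
        using P[of T] that S e by simp
    qed
  qed
  then show ?thesis using Z unfolding nonsing_M_def by simp
qed

text \<open>The matrix with \<open>e > 0\<close> added on the diagonal is nonsingular; its minors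
  are continuous in \<open>e\<close>, so the weak inequality survives the limit at 0 from the
  right.\<close>

lemma minor_sum_step_M_matrix:
  assumes A: "A \<in> carrier_mat n n" and M: "M_matrix A" and k: "k < m"
  shows "real (m - k + 1) * minor_sum (m + 1) (m - 1) k A \<le> real (m - k) * minor_sum m m k A"
proof -
  define a where "a = (\<lambda>i j. A $$ (i, j))"
  define ae where "ae = (\<lambda>e i j. a i j + (if i = j then e else 0))"
  define s where "s = (\<lambda>m1 m2 e. \<Sum>(\<alpha>, \<beta>)\<in>index_pairs n m1 m2 k. pminor (ae e) \<alpha> * pminor (ae e) \<beta>)"
  have s0: "minor_sum m1 m2 k A = s m1 m2 0" for m1 m2
    unfolding s_def ae_def using minor_sum_eq_pminor[OF A] by (simp add: a_def)
  have "nonsing_M (ae e) {..<n}" if "0 < e" for e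
    unfolding ae_def
  proof (rule nonsing_M_add_diagonal[OF _ _ _ that])
    show "a i j \<le> 0" if "i \<in> {..<n}" "j \<in> {..<n}" "i \<noteq> j" for i j
      using M A that unfolding M_matrix_def a_def by auto
    show "0 \<le> pminor a S" if "S \<subseteq> {..<n}" for S
      using M A that principal_minor_eq_pminor[OF A that] unfolding M_matrix_def a_def by auto
  qed simp
  then have ineq: "real (m - k + 1) * s (m + 1) (m - 1) e \<le> real (m - k) * s m m e" if "0 < e" for e
    unfolding s_def using that k by (intro pair_sum_step_nonsing) auto
  have pm: "((\<lambda>e. pminor (ae e) S) \<longlongrightarrow> pminor (ae 0) S) (at_right 0)" for S
  proof -
    have "((\<lambda>e. if i = j then e else 0) \<longlongrightarrow> (if i = j then 0 else 0)) (at_right (0::real))" for i j :: nat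
      by (cases "i = j") auto
    then show ?thesis unfolding pminor_def ae_def by (intro tendsto_intros)
  qed
  have lim: "((\<lambda>e. s m1 m2 e) \<longlongrightarrow> s m1 m2 0) (at_right 0)" for m1 m2
    unfolding s_def case_prod_unfold by (intro tendsto_intros pm)
  have "real (m - k + 1) * s (m + 1) (m - 1) 0 \<le> real (m - k) * s m m 0"
  proof (rule tendsto_le)
    show "((\<lambda>e. real (m - k) * s m m e) \<longlongrightarrow> real (m - k) * s m m 0) (at_right 0)"
      by (intro tendsto_intros lim)
    show "((\<lambda>e. real (m - k + 1) * s (m + 1) (m - 1) e) \<longlongrightarrow> real (m - k + 1) * s (m + 1) (m - 1) 0) (at_right 0)"
      by (intro tendsto_intros lim)
    show "\<forall>\<^sub>F e in at_right 0. real (m - k + 1) * s (m + 1) (m - 1) e \<le> real (m - k) * s m m e"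
      using eventually_at_right_less[of "0::real"] by eventually_elim (rule ineq)
  qed simp
  then show ?thesis unfolding s0 .
qed

section \<open>Inverse M-matrices\<close>

lemma minor_sum_swap: "minor_sum m1 m2 k A = minor_sum m2 m1 k A"
  unfolding minor_sum_def
  by (rule sum.reindex_bij_witness[where i = "\<lambda>(\<alpha>, \<beta>). (\<beta>, \<alpha>)" and j = "\<lambda>(\<alpha>, \<beta>). (\<beta>, \<alpha>)"])
    (auto simp: Int_commute)

lemma index_pairs_empty:
  assumes "n + k < m1 + m2"
  shows "index_pairs n m1 m2 k = {}"
proof (rule ccontr)
  assume "index_pairs n m1 m2 k \<noteq> {}"
  then obtain \<alpha> \<beta> where q: "\<alpha> \<subseteq> {..<n}" "\<beta> \<subseteq> {..<n}"
      "card \<alpha> = m1" "card \<beta> = m2" "card (\<alpha> \<inter> \<beta>) = k" by (auto simp: index_pairs_def)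
  have f: "finite \<alpha>" "finite \<beta>" using q finite_subset by blast+
  have "card (\<alpha> \<union> \<beta>) \<le> n" using card_mono[of "{..<n}" "\<alpha> \<union> \<beta>"] q by simp
  then show False using card_Un_Int[OF f] q assms by simp
qed

text \<open>Both index sets are replaced by their complements. Jacobi's identity gives one factor
  \<open>det A\<close> for each, and the complements meet in the complement of
  \<open>\<alpha> \<union> \<beta>\<close>.\<close>

lemma minor_sum_inverse:
  assumes A: "A \<in> carrier_mat n n" and B: "B \<in> carrier_mat n n" and BA: "B * A = 1\<^sub>m n"
    and m: "m1 \<le> n" "m2 \<le> n" "m1 + m2 \<le> n + k"
  shows "minor_sum m1 m2 k A = (det A)\<^sup>2 * minor_sum (n - m1) (n - m2) (n + k - (m1 + m2)) B"
proof -
  let ?a = "\<lambda>i j. A $$ (i, j)" and ?b = "\<lambda>i j. B $$ (i, j)"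
  \<comment> \<open>Stated for arbitrary sizes, since both directions of the bijection use
    it.\<close>
  have maps: "({..<n} - \<alpha>, {..<n} - \<beta>) \<in> index_pairs n (n - m1) (n - m2) (n + k - (m1 + m2))"
    if "(\<alpha>, \<beta>) \<in> index_pairs n m1 m2 k" for \<alpha> \<beta> m1 m2 k
  proof -
    have q: "\<alpha> \<subseteq> {..<n}" "\<beta> \<subseteq> {..<n}" "card \<alpha> = m1" "card \<beta> = m2" "card (\<alpha> \<inter> \<beta>) = k"
      using that by (auto simp: index_pairs_def)
    have f: "finite \<alpha>" "finite \<beta>" using q finite_subset by blast+
    have "({..<n} - \<alpha>) \<inter> ({..<n} - \<beta>) = {..<n} - (\<alpha> \<union> \<beta>)" by auto
    then have "card (({..<n} - \<alpha>) \<inter> ({..<n} - \<beta>)) = n - card (\<alpha> \<union> \<beta>)"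
      using f q by (simp add: card_Diff_subset)
    also have "\<dots> = n + k - (m1 + m2)" using card_Un_Int[OF f] q by simp
    finally show ?thesis using f q by (simp add: index_pairs_def card_Diff_subset)
  qed
  have "minor_sum m1 m2 k A = (\<Sum>(\<alpha>, \<beta>)\<in>index_pairs n m1 m2 k.
      (det A)\<^sup>2 * (pminor ?b ({..<n} - \<alpha>) * pminor ?b ({..<n} - \<beta>)))"
    unfolding minor_sum_eq_pminor[OF A]
    by (intro sum.cong refl) (auto simp: index_pairs_def pminor_jacobi[OF A B BA] power2_eq_square)
  also have "\<dots> = (\<Sum>(\<alpha>, \<beta>)\<in>index_pairs n (n - m1) (n - m2) (n + k - (m1 + m2)).
      (det A)\<^sup>2 * (pminor ?b \<alpha> * pminor ?b \<beta>))"
  proof (rule sum.reindex_bij_witness[where i = "\<lambda>(\<alpha>, \<beta>). ({..<n} - \<alpha>, {..<n} - \<beta>)"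
        and j = "\<lambda>(\<alpha>, \<beta>). ({..<n} - \<alpha>, {..<n} - \<beta>)"])
    fix q assume "q \<in> index_pairs n (n - m1) (n - m2) (n + k - (m1 + m2))"
    moreover have "n - (n - m1) = m1" "n - (n - m2) = m2"
      "n + (n + k - (m1 + m2)) - (n - m1 + (n - m2)) = k" using m by auto
    ultimately show "(case q of (\<alpha>, \<beta>) \<Rightarrow> ({..<n} - \<alpha>, {..<n} - \<beta>)) \<in> index_pairs n m1 m2 k"
      using maps[of "fst q" "snd q" "n - m1" "n - m2" "n + k - (m1 + m2)"] by (simp add: case_prod_unfold)
  qed (use maps in \<open>auto simp: index_pairs_def double_diff\<close>)
  also have "\<dots> = (det A)\<^sup>2 * minor_sum (n - m1) (n - m2) (n + k - (m1 + m2)) B"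
    unfolding minor_sum_eq_pminor[OF B] by (simp add: sum_distrib_left case_prod_unfold)
  finally show ?thesis .
qed

text \<open>Complementation turns the sizes \<open>m + 1\<close> and \<open>m - 1\<close> into
  \<open>n - m - 1\<close> and \<open>n - m + 1\<close>, which are swapped to fit the inequality for
  the inverse. If \<open>m + m > n + k\<close>, both sums are empty.\<close>

lemma minor_sum_step_inverse_M_matrix:
  assumes A: "A \<in> carrier_mat n n" and M: "inverse_M_matrix A" and m: "m < n" and k: "k < m"
  shows "real (m - k + 1) * minor_sum (m + 1) (m - 1) k A \<le> real (m - k) * minor_sum m m k A"
proof (cases "m + m \<le> n + k")
  case True
  obtain B where B: "inverts_mat A B" "inverts_mat B A" "M_matrix B"
    using M unfolding inverse_M_matrix_def by blast
  have AB: "A * B = 1\<^sub>m n" using B(1) A unfolding inverts_mat_def by auto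
  have BA': "B * A = 1\<^sub>m (dim_row B)" using B(2) unfolding inverts_mat_def .
  \<comment> \<open>The dimensions of \<open>B\<close> are not fixed by \<open>inverts_mat\<close>;
    the column counts of the two products determine them.\<close>
  have "dim_col (A * B) = n" "dim_col (B * A) = dim_row B" unfolding AB BA' by simp_all
  then have Bc: "B \<in> carrier_mat n n" using A by auto
  then have BA: "B * A = 1\<^sub>m n" using BA' by simp
  \<comment> \<open>The common size of the intersections after complementation. The condition
    \<open>k' < n - m\<close> is \<open>k < m\<close> again, and the coefficients agree because
    \<open>n - m - k' = m - k\<close>.\<close>
  define k' where "k' = n + k - (m + m)"
  have k': "k' < n - m" "n - m - k' = m - k" using True m k unfolding k'_def by auto
  have "minor_sum (m + 1) (m - 1) k A = (det A)\<^sup>2 * minor_sum (n - (m + 1)) (n - (m - 1)) k' B"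
    using minor_sum_inverse[OF A Bc BA, of "m + 1" "m - 1" k] True m k unfolding k'_def by simp
  also have "n - (m + 1) = n - m - 1" by simp
  also have "n - (m - 1) = n - m + 1" using m k by simp
  also have "minor_sum (n - m - 1) (n - m + 1) k' B = minor_sum (n - m + 1) (n - m - 1) k' B"
    by (rule minor_sum_swap)
  finally have s1: "minor_sum (m + 1) (m - 1) k A = (det A)\<^sup>2 * minor_sum (n - m + 1) (n - m - 1) k' B" .
  have s0: "minor_sum m m k A = (det A)\<^sup>2 * minor_sum (n - m) (n - m) k' B"
    using minor_sum_inverse[OF A Bc BA, of m m k] True m unfolding k'_def by simp
  have "real (m - k + 1) * minor_sum (n - m + 1) (n - m - 1) k' B \<le> real (m - k) * minor_sum (n - m) (n - m) k' B"
    using minor_sum_step_M_matrix[OF Bc B(3) k'(1)] unfolding k'(2) .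
  then have "(det A)\<^sup>2 * (real (m - k + 1) * minor_sum (n - m + 1) (n - m - 1) k' B) \<le>
      (det A)\<^sup>2 * (real (m - k) * minor_sum (n - m) (n - m) k' B)"
    by (intro mult_left_mono) auto
  then show ?thesis unfolding s1 s0 by (simp only: mult.left_commute)
next
  case False
  then have "index_pairs n m m k = {}" "index_pairs n (m + 1) (m - 1) k = {}"
    using k by (auto intro!: index_pairs_empty)
  then show ?thesis unfolding minor_sum_eq_pminor[OF A] by simp
qed

section \<open>Normalization by the identity matrix\<close>

text \<open>All principal minors of the identity are 1, so this counts the index pairs: a core pair
  together with a choice of \<open>S\<close> inside \<open>W\<close>.\<close>

lemma minor_sum_one:
  assumes "k \<le> m1" "k \<le> m2"
  shows "minor_sum m1 m2 k (1\<^sub>m n) =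
    card (core_pairs n k (m1 + m2 - 2 * k)) * ((m1 + m2 - 2 * k) choose (m1 - k))"
proof -
  have one: "pminor (\<lambda>i j. 1\<^sub>m n $$ (i, j)) S = 1" if S: "S \<subseteq> {..<n}" for S
    unfolding pminor_eq_det[OF S] det_one[of n, symmetric]
    by (intro arg_cong[where f = det] eq_matI) auto
  have "minor_sum m1 m2 k (1\<^sub>m n) = (\<Sum>(\<alpha>, \<beta>)\<in>index_pairs n m1 m2 k. 1)"
    unfolding minor_sum_eq_pminor[OF one_carrier_mat]
    by (intro sum.cong refl) (auto simp: index_pairs_def one)
  also have "\<dots> = (\<Sum>(\<gamma>, W)\<in>core_pairs n k (m1 + m2 - 2 * k). \<Sum>S | S \<subseteq> W \<and> card S = m1 - k. 1)"
    by (rule sum_index_pairs[OF assms])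
  also have "\<dots> = (\<Sum>(\<gamma>, W)\<in>core_pairs n k (m1 + m2 - 2 * k). real ((m1 + m2 - 2 * k) choose (m1 - k)))"
  proof (intro sum.cong refl, clarify)
    fix \<gamma> W assume "(\<gamma>, W) \<in> core_pairs n k (m1 + m2 - 2 * k)"
    then have "finite W" "card W = m1 + m2 - 2 * k"
      using finite_subset[of W "{..<n} - \<gamma>"] by (auto simp: core_pairs_def)
    then show "(\<Sum>S | S \<subseteq> W \<and> card S = m1 - k. 1) = real ((m1 + m2 - 2 * k) choose (m1 - k))"
      using n_subsets[of W "m1 - k"] by simp
  qed
  finally show ?thesis by simp
qed

theorem theorem1:
  fixes A :: "real mat" and n m k :: nat
  assumes "A \<in> carrier_mat n n"
    and "M_matrix A \<or> inverse_M_matrix A"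
    and "m < n" and "k < m"
  shows "minor_sum m m k A / minor_sum m m k (1\<^sub>m n)
       \<ge> minor_sum (m + 1) (m - 1) k A / minor_sum (m + 1) (m - 1) k (1\<^sub>m n)"
proof -
  define p where "p = m - k"
  let ?s0 = "minor_sum m m k A" and ?s1 = "minor_sum (m + 1) (m - 1) k A"
  let ?c0 = "minor_sum m m k (1\<^sub>m n)" and ?c1 = "minor_sum (m + 1) (m - 1) k (1\<^sub>m n)"
  have p: "0 < p" using assms(4) unfolding p_def by simp
  have step: "real (p + 1) * ?s1 \<le> real p * ?s0"
    using assms minor_sum_step_M_matrix minor_sum_step_inverse_M_matrix unfolding p_def by blast
  have c0: "?c0 = real (card (core_pairs n k (2 * p)) * ((2 * p) choose p))"
    using minor_sum_one[of k m m n] assms(4) by (simp add: p_def diff_mult_distrib2 mult_2)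
  have c1: "?c1 = real (card (core_pairs n k (2 * p)) * ((2 * p) choose (p + 1)))"
  proof -
    have "m + 1 + (m - 1) - 2 * k = 2 * p" "m + 1 - k = p + 1" using assms(4) unfolding p_def by auto
    then show ?thesis using minor_sum_one[of k "m + 1" "m - 1" n] assms(4) by simp
  qed
  \<comment> \<open>The ratio of the two normalizations is the ratio of the coefficients in
    \<open>step\<close>.\<close>
  have "(p + 1) * ((2 * p) choose (p + 1)) = p * ((2 * p) choose p)"
    using binomial_absorb_comp[of "2 * p" p] binomial_absorption[of p "2 * p"] p by simp
  then have "real (p + 1) * ?c1 = real p * ?c0"
    unfolding c0 c1 by (metis (no_types, lifting) mult.left_commute of_nat_mult)
  moreover have "0 \<le> ?c0" unfolding c0 by simp
  ultimately have "?s1 / ?c1 = (real (p + 1) * ?s1) / (real p * ?c0)"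
    using mult_divide_mult_cancel_left[of "real (p + 1)" ?s1 ?c1] by simp
  \<comment> \<open>If there are no core pairs, \<open>?c0\<close> and \<open>?c1\<close> are both 0
    and all quotients are 0; a nonnegative denominator is enough for this step.\<close>
  also have "\<dots> \<le> (real p * ?s0) / (real p * ?c0)"
    using step \<open>0 \<le> ?c0\<close> by (intro divide_right_mono) auto
  also have "\<dots> = ?s0 / ?c0" using p by simp
  finally show ?thesis .
qed

end
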